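(* Let $\mathcal O$ be a nonmaximal order in an algebraic number field $K$, let $\mathcal O_K$ be the ring of integers of $K$, and let $\mathfrak c=\{x\in K: x\mathcal O_K\subset\mathcal O\}$ be the conductor of $\mathcal O$. Let $m\in\mathbb Z$ be the least positive integer such that $m\mathcal O_K\subset\mathcal O$ and let $H\subset\mathcal O_K$ be a complete set of representatives for the nontrivial cosets of $m\mathcal O_K$ in $\mathcal O_K$. For each $h\in H$ let $n_h$ be the least positive integer such that $n_h\mathcal O_K\subset h\mathcal O_K$, put $h':=n_h/h\in\mathcal O_K$, and define a fractional $\mathcal O$-ideal $I_h$ by $$I_h:=\begin{cases}\tfrac1{h'}m\mathcal O\cap\mathcal O_K&\text{if }h'\in\mathfrak c,\\ \tfrac1{h'}\mathcal O\cap\mathcal O_K&\text{if }h'\notin\mathfrak c.\end{cases}$$ Then $h+m\mathcal O_K\subset I_h\subsetneq\mathcal O_K$ for every $h\in H$, and $$\mathcal O_K=\bigcup_{h\in H}I_h.$$ As a consequence, the monoids $\mathcal O^\times$ and $\mathcal O\rtimes\mathcal O^\times$ do not satisfy independence.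
   Context: An order in a number field $K$ is a subring (with $1$) of $\mathcal O_K$ that is free of full rank $[K:\mathbb Q]$ as a $\mathbb Z$-module; it is nonmaximal if it is different from $\mathcal O_K$. $\mathcal O^\times:=\mathcal O\setminus\{0\}$ is the multiplicative monoid, a submonoid of $K^*$. The $ax+b$-monoid $\mathcal O\rtimes\mathcal O^\times$ has operation $(b,a)(d,c)=(b+ad,ac)$ and is a submonoid of the group $K\rtimes K^*$. Independence: for a submonoid $P$ of a group and $p_1,\ldots,p_{2k}\in P$ ($k\ge0$), the set $P\cap p_{2k}^{-1}p_{2k-1}P\cap p_{2k}^{-1}p_{2k-1}p_{2k-2}^{-1}p_{2k-3}P\cap\cdots\cap p_{2k}^{-1}p_{2k-1}\cdots p_2^{-1}p_1P$ is called a constructible right ideal of $P$. $P$ satisfies independence if whenever a finite union of constructible right ideals of $P$ is itself a constructible right ideal $S$, then $S$ is one of the members of the union. *)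

theory Defs
  imports
    Complex_Main
    "HOL-Algebra.Coset"
    "HOL-Computational_Algebra.Polynomial"
    "HOL-Library.Set_Algebras"
begin

section \<open>Number fields and orders\<close>

definition rat_scale :: "rat \<Rightarrow> 'a::field_char_0 \<Rightarrow> 'a" where
  "rat_scale q x = of_rat q * x"

definition int_scale :: "int \<Rightarrow> 'a::field_char_0 \<Rightarrow> 'a" where
  "int_scale n x = of_int n * x"

global_interpretation Qvec: vector_space "rat_scale :: rat \<Rightarrow> 'a::field_char_0 \<Rightarrow> 'a"
  by unfold_locales (simp_all add: rat_scale_def algebra_simps of_rat_add of_rat_mult)

global_interpretation Zmod: module "int_scale :: int \<Rightarrow> 'a::field_char_0 \<Rightarrow> 'a"
  by unfold_locales (simp_all add: int_scale_def algebra_simps)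

text \<open>A number field is rendered as the universe of a type: a field of characteristic zero that is
  finite-dimensional over the rationals.\<close>

definition is_number_field :: "'a::field_char_0 itself \<Rightarrow> bool" where
  "is_number_field T \<longleftrightarrow> (\<exists>B :: 'a set. finite B \<and> Qvec.span B = UNIV)"

definition ring_of_integers :: "'a::field_char_0 set"  (\<open>\<O>\<^sub>K\<close>) where
  "\<O>\<^sub>K = {x. algebraic_int x}"

definition is_subring :: "'a::comm_ring_1 set \<Rightarrow> bool" where
  "is_subring R \<longleftrightarrow>
     0 \<in> R \<and> 1 \<in> R \<and> (\<forall>x\<in>R. - x \<in> R) \<and> (\<forall>x\<in>R. \<forall>y\<in>R. x + y \<in> R \<and> x * y \<in> R)"

definition is_order :: "'a::field_char_0 set \<Rightarrow> bool" where
  "is_order R \<longleftrightarrow> is_subring R \<and> R \<subseteq> \<O>\<^sub>K \<and>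
     (\<exists>B. finite B \<and> Zmod.independent B \<and> Zmod.span B = R \<and> card B = Qvec.dim (UNIV :: 'a set))"

definition is_nonmaximal_order :: "'a::field_char_0 set \<Rightarrow> bool" where
  "is_nonmaximal_order R \<longleftrightarrow> is_order R \<and> R \<noteq> \<O>\<^sub>K"

definition is_fractional_ideal :: "'a::field_char_0 set \<Rightarrow> 'a set \<Rightarrow> bool" where
  "is_fractional_ideal R I \<longleftrightarrow>
     0 \<in> I \<and> I \<noteq> {0} \<and> (\<forall>x\<in>I. \<forall>y\<in>I. x + y \<in> I) \<and> (\<forall>r\<in>R. \<forall>x\<in>I. r * x \<in> I) \<and>
     (\<exists>d\<in>R. d \<noteq> 0 \<and> d *o I \<subseteq> R)"

definition conductor :: "'a::field_char_0 set \<Rightarrow> 'a set" where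
  "conductor R = {x. x *o \<O>\<^sub>K \<subseteq> R}"

definition least_mult :: "'a::field_char_0 set \<Rightarrow> nat" where
  "least_mult R = (LEAST m. 0 < m \<and> of_nat m *o \<O>\<^sub>K \<subseteq> R)"

definition is_nontrivial_coset_reps :: "nat \<Rightarrow> 'a::field_char_0 set \<Rightarrow> bool" where
  "is_nontrivial_coset_reps m H \<longleftrightarrow> H \<subseteq> \<O>\<^sub>K \<and>
     bij_betw (\<lambda>h. h +o (of_nat m *o \<O>\<^sub>K)) H
       ((\<lambda>x. x +o (of_nat m *o \<O>\<^sub>K)) ` \<O>\<^sub>K - {of_nat m *o \<O>\<^sub>K})"

definition cofactor :: "'a::field_char_0 \<Rightarrow> 'a" where
  "cofactor h = of_nat (least_mult (h *o \<O>\<^sub>K)) / h"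

definition covering_ideal :: "'a::field_char_0 set \<Rightarrow> 'a \<Rightarrow> 'a set" where
  "covering_ideal R h =
     (if cofactor h \<in> conductor R
      then ((1 / cofactor h) *o (of_nat (least_mult R) *o R)) \<inter> \<O>\<^sub>K
      else ((1 / cofactor h) *o R) \<inter> \<O>\<^sub>K)"

section \<open>Constructible right ideals and independence\<close>

text \<open>The list \<open>ps\<close> of pairs encodes
  \<open>[(p\<^bsub>2k\<^esub>, p\<^bsub>2k-1\<^esub>), (p\<^bsub>2k-2\<^esub>, p\<^bsub>2k-3\<^esub>), \<dots>, (p\<^sub>2, p\<^sub>1)]\<close>, so that its prefix of length \<open>j\<close> gives the word
  \<open>p\<^bsub>2k\<^esub>\<^sup>-\<^sup>1 p\<^bsub>2k-1\<^esub> \<dots> p\<^bsub>2k-2j+2\<^esub>\<^sup>-\<^sup>1 p\<^bsub>2k-2j+1\<^esub>\<close>.\<close>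

primrec quotient_word :: "('g, 'm) monoid_scheme \<Rightarrow> ('g \<times> 'g) list \<Rightarrow> 'g" where
  "quotient_word G [] = \<one>\<^bsub>G\<^esub>"
| "quotient_word G (pq # ps) = inv\<^bsub>G\<^esub> (fst pq) \<otimes>\<^bsub>G\<^esub> snd pq \<otimes>\<^bsub>G\<^esub> quotient_word G ps"

definition constructible_ideal :: "('g, 'm) monoid_scheme \<Rightarrow> 'g set \<Rightarrow> ('g \<times> 'g) list \<Rightarrow> 'g set" where
  "constructible_ideal G P ps =
     P \<inter> (\<Inter>j\<in>{1..length ps}. quotient_word G (take j ps) <#\<^bsub>G\<^esub> P)"

definition constructible_ideals :: "('g, 'm) monoid_scheme \<Rightarrow> 'g set \<Rightarrow> 'g set set" where
  "constructible_ideals G P = {constructible_ideal G P ps | ps. set ps \<subseteq> P \<times> P}"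

text \<open>The union is over a nonempty family: the empty set can itself be a constructible right ideal,
  and admitting it as the empty union would make independence fail for that trivial reason.\<close>

definition satisfies_independence :: "('g, 'm) monoid_scheme \<Rightarrow> 'g set \<Rightarrow> bool" where
  "satisfies_independence G P \<longleftrightarrow>
     (\<forall>\<C>. finite \<C> \<and> \<C> \<noteq> {} \<and> \<C> \<subseteq> constructible_ideals G P \<and> \<Union>\<C> \<in> constructible_ideals G P
        \<longrightarrow> \<Union>\<C> \<in> \<C>)"

section \<open>The ambient groups and the monoids of an order\<close>

definition mult_group :: "'a::field monoid" where
  "mult_group = \<lparr>carrier = UNIV - {0}, monoid.mult = (*), one = 1\<rparr>"

definition affine_group :: "('a::field \<times> 'a) monoid" where
  "affine_group =
     \<lparr>carrier = UNIV \<times> (UNIV - {0}), monoid.mult = (\<lambda>(b, a) (d, c). (b + a * d, a * c)), one = (0, 1)\<rparr>"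

definition mult_monoid :: "'a::field set \<Rightarrow> 'a set" where
  "mult_monoid R = R - {0}"

definition affine_monoid :: "'a::field set \<Rightarrow> ('a \<times> 'a) set" where
  "affine_monoid R = R \<times> mult_monoid R"

lemma group_mult_group: "group (mult_group :: 'a::field monoid)"
proof (rule groupI)
  fix x :: 'a
  assume "x \<in> carrier mult_group"
  then show "\<exists>y\<in>carrier mult_group. y \<otimes>\<^bsub>mult_group\<^esub> x = \<one>\<^bsub>mult_group\<^esub>"
    by (intro bexI[of _ "inverse x"]) (auto simp: mult_group_def)
qed (auto simp: mult_group_def)

lemma group_affine_group: "group (affine_group :: ('a::field \<times> 'a) monoid)"
proof (rule groupI)
  fix x :: "'a \<times> 'a"
  assume "x \<in> carrier affine_group"
  then show "\<exists>y\<in>carrier affine_group. y \<otimes>\<^bsub>affine_group\<^esub> x = \<one>\<^bsub>affine_group\<^esub>"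
    by (intro bexI[of _ "(- fst x / snd x, inverse (snd x))"])
       (auto simp: affine_group_def field_simps)
qed (auto simp: affine_group_def algebra_simps)

lemma submonoid_mult_monoid: "is_subring R \<Longrightarrow> submonoid (mult_monoid R) (mult_group :: 'a::field monoid)"
  by unfold_locales (auto simp: mult_group_def mult_monoid_def is_subring_def)

lemma submonoid_affine_monoid:
  "is_subring R \<Longrightarrow> submonoid (affine_monoid R) (affine_group :: ('a::field \<times> 'a) monoid)"
  by unfold_locales (auto simp: affine_group_def affine_monoid_def mult_monoid_def is_subring_def)

end

theory Submission
  imports "Jordan_Normal_Form.Schur_Decomposition" Defs
begin

text \<open>Every \<open>I\<^sub>h\<close> contains \<open>h + m \<O>\<^sub>K\<close> and also \<open>m \<O>\<^sub>K\<close>, whence the covering; when \<open>h'\<close> lies in the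
  conductor \<open>c\<close>, this rests on \<open>m\<close> dividing \<open>n\<^sub>h\<close>. Properness of \<open>I\<^sub>h\<close> is the definition of \<open>c\<close>
  or the minimality of \<open>n\<^sub>h\<close>. That \<open>m\<close> exists at all follows from the trace form: traces of integral
  elements are integers, so the determinant of the form on a basis of the order clears the
  denominators of all of \<open>\<O>\<^sub>K\<close>.

  For independence, \<open>\<O>\<^sub>K = (R : c)\<close> and \<open>c\<close> is finitely generated, so \<open>\<O>\<^sub>K\<close> is a finite
  intersection of principal fractional ideals of the order \<open>R\<close>. Hence \<open>m \<O>\<^sub>K\<close> and the \<open>m I\<^sub>h\<close> are
  constructible, and \<open>m \<O>\<^sub>K\<close> is a finite union of the strictly smaller \<open>m I\<^sub>h\<close>. In the
  \<open>ax + b\<close>-monoid one takes all the sets \<open>(b + m I\<^sub>h) \<times> (m I\<^sub>h - {0})\<close> with \<open>b \<in> m \<O>\<^sub>K\<close>, of which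
  there are finitely many.\<close>

section \<open>Algebraic integers\<close>

text \<open>Determinant trick: multiplication by \<open>x\<close> acts on the listed generators
  through an integer matrix \<open>A\<close>, so the vector of generators is an eigenvector with
  eigenvalue \<open>x\<close>, nonzero because of \<open>f\<close>. Hence \<open>x\<close> is a root
  of the monic integral polynomial \<open>char_poly A\<close>.\<close>

lemma algebraic_int_if_stabilizes:
  fixes x :: "'a::field_char_0"
  assumes fin: "finite F" and f: "f \<in> F" "f \<noteq> 0"
    and stable: "\<And>y. y \<in> F \<Longrightarrow> x * y \<in> Zmod.span F"
  shows "algebraic_int x"
proof -
  obtain fs where fs: "set fs = F" "distinct fs"
    using fin finite_distinct_list by blast
  define n where "n = length fs"
  have "\<forall>y\<in>F. \<exists>u. x * y = (\<Sum>z\<in>F. int_scale (u z) z)"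
    using stable by (fastforce simp: Zmod.span_finite[OF fin])
  then obtain u where u: "\<And>y. y \<in> F \<Longrightarrow> x * y = (\<Sum>z\<in>F. int_scale (u y z) z)"
    by metis
  define A where "A = mat n n (\<lambda>(i, j). u (fs ! i) (fs ! j))"
  define v where "v = vec n (\<lambda>i. fs ! i)"
  have A: "A \<in> carrier_mat n n" by (simp add: A_def)
  have A': "map_mat of_int A \<in> carrier_mat n n" by (simp add: A_def)
  obtain k where k: "k < n" "fs ! k = f"
    using f(1) fs(1) by (auto simp: n_def in_set_conv_nth)
  have "map_mat of_int A *\<^sub>v v = x \<cdot>\<^sub>v v"
  proof (rule eq_vecI)
    fix i assume "i < dim_vec (x \<cdot>\<^sub>v v)"
    then have i: "i < n" by (simp add: v_def)
    have "(map_mat of_int A *\<^sub>v v) $ i = (\<Sum>j<n. of_int (u (fs ! i) (fs ! j)) * fs ! j)"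
      using i by (simp add: A_def v_def scalar_prod_def atLeast0LessThan)
    also have "\<dots> = (\<Sum>z\<in>F. of_int (u (fs ! i) z) * z)"
      using sum.reindex_bij_betw[OF bij_betw_nth[OF fs(2) refl refl], of "\<lambda>z. of_int (u (fs ! i) z) * z"]
      by (simp add: n_def fs(1))
    also have "\<dots> = x * fs ! i"
      using u[of "fs ! i"] i fs(1) nth_mem[of i fs] by (simp add: int_scale_def n_def)
    finally show "(map_mat of_int A *\<^sub>v v) $ i = (x \<cdot>\<^sub>v v) $ i"
      using i by (simp add: v_def)
  qed (simp add: A_def v_def)
  moreover have "v \<noteq> 0\<^sub>v n"
  proof
    assume "v = 0\<^sub>v n"
    then have "v $ k = 0" using k by simp
    then show False using k f(2) by (simp add: v_def)
  qed
  ultimately have "eigenvector (map_mat of_int A) v x"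
    by (simp add: eigenvector_def A_def v_def)
  then have "poly (char_poly (map_mat of_int A)) x = 0"
    using eigenvalue_root_char_poly[OF A'] by (auto simp: eigenvalue_def)
  then have "poly (map_poly of_int (char_poly A)) x = 0"
    by (simp add: of_int_hom.char_poly_hom[OF A])
  then show ?thesis
    using degree_monic_char_poly[OF A] unfolding algebraic_int_altdef_ipoly by metis
qed

text \<open>A monic integral equation of degree \<open>a\<close> rewrites each power from
  \<open>x ^ a\<close> on through lower ones. The multiplier \<open>z\<close> and the submodule
  \<open>S\<close> are left free so that the rule can be applied to two elements in turn.\<close>

lemma algebraic_int_powers:
  fixes x :: "'a::field_char_0"
  assumes "algebraic_int x"
  obtains a where "a > 0"
    "\<And>S z k. Zmod.subspace S \<Longrightarrow> (\<And>i. i < a \<Longrightarrow> z * x ^ i \<in> S) \<Longrightarrow> z * x ^ k \<in> S"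
proof -
  obtain p where p: "poly (map_poly of_int p) x = 0" "lead_coeff p = 1"
    using assms unfolding algebraic_int_altdef_ipoly by blast
  define a where "a = degree p"
  have pa: "coeff p a = 1" using p(2) by (simp add: a_def)
  have eq: "(\<Sum>i\<le>a. of_int (coeff p i) * x ^ i) = 0"
    using p(1) by (simp add: poly_altdef a_def degree_map_poly)
  then have eq': "x ^ a = - (\<Sum>i<a. of_int (coeff p i) * x ^ i)"
    using pa by (simp add: atLeast0AtMost[symmetric] lessThan_Suc_atMost[symmetric] add_eq_0_iff
        atLeast0LessThan[symmetric] atLeastLessThanSuc_atLeastAtMost[symmetric])
  \<comment> \<open>A monic polynomial of degree zero is 1 and has no root.\<close>
  have "a > 0"
    using eq pa by (intro Nat.gr0I) auto
  moreover have "z * x ^ k \<in> S" if S: "Zmod.subspace S" "\<And>i. i < a \<Longrightarrow> z * x ^ i \<in> S" for S z k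
  proof (induction k rule: less_induct)
    case (less k)
    show ?case
    proof (cases "k < a")
      case False
      then have "z * x ^ k = (z * x ^ (k - a)) * x ^ a"
        by (simp flip: power_add)
      also have "\<dots> = - (\<Sum>i<a. int_scale (coeff p i) (z * x ^ (k - a + i)))"
        by (simp add: eq' sum_distrib_left int_scale_def power_add mult_ac)
      also have "\<dots> \<in> S"
        using False by (intro Zmod.subspace_neg Zmod.subspace_sum Zmod.subspace_scale S(1) less.IH) auto
      finally show ?thesis .
    qed (use S in auto)
  qed
  ultimately show ?thesis using that by blast
qed

text \<open>The monomials with exponents below \<open>a\<close> and \<open>b\<close> include 1 and
  span all \<open>x ^ i * y ^ j\<close>. Their span is therefore stable under \<open>x + y\<close>
  and \<open>x * y\<close>, and the determinant trick applies to both.\<close>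

lemma
  fixes x y :: "'a::field_char_0"
  assumes "algebraic_int x" "algebraic_int y"
  shows algebraic_int_add: "algebraic_int (x + y)"
    and algebraic_int_mult: "algebraic_int (x * y)"
proof -
  obtain a where a: "a > 0"
    "\<And>S z k. Zmod.subspace S \<Longrightarrow> (\<And>i. i < a \<Longrightarrow> z * x ^ i \<in> S) \<Longrightarrow> z * x ^ k \<in> S"
    using algebraic_int_powers[OF assms(1)] by blast
  obtain b where b: "b > 0"
    "\<And>S z k. Zmod.subspace S \<Longrightarrow> (\<And>i. i < b \<Longrightarrow> z * y ^ i \<in> S) \<Longrightarrow> z * y ^ k \<in> S"
    using algebraic_int_powers[OF assms(2)] by blast
  define F where "F = (\<lambda>(i, j). y ^ j * x ^ i) ` ({..<a} \<times> {..<b})"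
  have base: "y ^ j * x ^ i \<in> Zmod.span F" if "j < b" for i j
  proof (rule a(2)[OF Zmod.subspace_span])
    fix i assume "i < a"
    with that have "y ^ j * x ^ i \<in> F" by (auto simp: F_def)
    then show "y ^ j * x ^ i \<in> Zmod.span F" by (rule Zmod.span_base)
  qed
  have mem: "x ^ i * y ^ j \<in> Zmod.span F" for i j
    by (rule b(2)[OF Zmod.subspace_span]) (use base in \<open>simp add: mult.commute\<close>)
  have fin: "finite F" by (simp add: F_def)
  have 1: "1 \<in> F" using a(1) b(1) by (auto simp: F_def intro!: image_eqI[where x = "(0, 0)"])
  show "algebraic_int (x + y)"
  proof (rule algebraic_int_if_stabilizes[OF fin 1])
    fix f assume "f \<in> F"
    then obtain i j where "f = y ^ j * x ^ i" by (auto simp: F_def)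
    then have "(x + y) * f = x ^ Suc i * y ^ j + x ^ i * y ^ Suc j"
      by (simp add: algebra_simps)
    then show "(x + y) * f \<in> Zmod.span F"
      using mem by (metis Zmod.span_add)
  qed simp
  show "algebraic_int (x * y)"
  proof (rule algebraic_int_if_stabilizes[OF fin 1])
    fix f assume "f \<in> F"
    then obtain i j where "f = y ^ j * x ^ i" by (auto simp: F_def)
    then have "(x * y) * f = x ^ Suc i * y ^ Suc j"
      by (simp add: algebra_simps)
    then show "(x * y) * f \<in> Zmod.span F"
      using mem by metis
  qed simp
qed

lemma is_subring_ring_of_integers: "is_subring (\<O>\<^sub>K :: 'a::field_char_0 set)"
  by (auto simp: is_subring_def ring_of_integers_def int_imp_algebraic_int
      intro: algebraic_int_add algebraic_int_mult)

lemma of_int_in_subring: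
  fixes R :: "'a::comm_ring_1 set"
  assumes "is_subring R"
  shows "of_int k \<in> R"
proof -
  have "of_nat n \<in> R" for n
    using assms by (induction n) (auto simp: is_subring_def)
  then show ?thesis
    using assms by (cases k) (auto simp: is_subring_def simp del: of_nat_Suc)
qed

lemma of_nat_in_subring:
  fixes R :: "'a::comm_ring_1 set"
  assumes "is_subring R"
  shows "of_nat k \<in> R"
  using of_int_in_subring[OF assms, of "int k"] by simp

lemma poly_of_int_in_subring:
  fixes R :: "'a::comm_ring_1 set"
  assumes R: "is_subring R" and "x \<in> R"
  shows "poly (map_poly of_int p) x \<in> R"
  by (induction p) (use assms in \<open>auto simp: is_subring_def map_poly_pCons of_int_in_subring[OF R]\<close>)

text \<open>A polynomial with root \<open>h\<close> and nonzero constant coefficient exhibits that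
  coefficient, up to sign, as \<open>h\<close> times an integral polynomial in
  \<open>h\<close>.\<close>

lemma algebraic_int_divides_nat:
  fixes h :: "'a::field_char_0"
  assumes "algebraic_int h" "h \<noteq> 0"
  obtains n :: nat where "n > 0" "algebraic_int (of_nat n / h)"
proof -
  \<comment> \<open>The induction strips factors of the variable: if the constant coefficient
    vanishes, the remaining factor still has the root \<open>h\<close>, because \<open>h\<close> is
    nonzero.\<close>
  have *: "\<exists>c q. c \<noteq> 0 \<and> of_int c = h * poly (map_poly of_int q) h"
    if "p \<noteq> 0" "poly (map_poly of_int p) h = 0" for p
    using that
  proof (induction p)
    case (pCons c q)
    show ?case
    proof (cases "c = 0")
      case False
      with pCons.prems have "of_int (- c) = h * poly (map_poly of_int q) h"
        by (simp add: map_poly_pCons add_eq_0_iff)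
      with False show ?thesis by (metis neg_equal_0_iff_equal)
    qed (use pCons assms in \<open>auto simp: map_poly_pCons\<close>)
  qed simp
  obtain p where "poly (map_poly of_int p) h = 0" "lead_coeff p = 1"
    using assms(1) unfolding algebraic_int_altdef_ipoly by blast
  then obtain c q where cq: "c \<noteq> 0" "of_int c = h * poly (map_poly of_int q) h"
    using *[of p] by (metis leading_coeff_0_iff zero_neq_one)
  have int: "algebraic_int (of_int c / h)"
    using poly_of_int_in_subring[OF is_subring_ring_of_integers, of h q] assms cq(2)
    by (simp add: ring_of_integers_def)
  have "of_nat (nat \<bar>c\<bar>) = (of_int c :: 'a) \<or> of_nat (nat \<bar>c\<bar>) = - (of_int c :: 'a)"
    by (cases "c \<ge> 0") (auto simp: of_nat_nat)
  with int have "algebraic_int (of_nat (nat \<bar>c\<bar>) / h)"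
    using algebraic_int_minus[OF int] by auto
  with cq(1) that show ?thesis by (metis zero_less_abs_iff zero_less_nat_eq)
qed

section \<open>The trace form of an order\<close>

lemma common_denominator:
  fixes u :: "'b \<Rightarrow> rat"
  assumes "finite B"
  shows "\<exists>D::int. D > 0 \<and> (\<forall>v\<in>B. of_int D * u v \<in> \<int>)"
  using assms
proof (induction B)
  case (insert w B)
  then obtain D :: int where D: "D > 0" "\<And>v. v \<in> B \<Longrightarrow> of_int D * u v \<in> \<int>" by blast
  obtain a b where ab: "b > 0" "u w = of_int a / of_int b"
    by (metis quotient_of_div quotient_of_denom_pos surj_pair)
  have "of_int (D * b) * u w = of_int (D * a)"
    using ab by simp
  moreover have "of_int (D * b) * u v = of_int b * (of_int D * u v)" for v
    by simp
  ultimately show ?case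
    using ab(1) D by (intro exI[of _ "D * b"]) (metis Ints_mult Ints_of_int insert_iff mult_pos_pos)
qed (auto intro: exI[of _ 1])

text \<open>Clearing denominators turns a rational relation into an integral one.\<close>

lemma independent_over_rationals:
  fixes B :: "'a::field_char_0 set"
  assumes fin: "finite B" and ind: "Zmod.independent B"
  shows "Qvec.independent B"
proof
  assume "Qvec.dependent B"
  then obtain u v where uv: "v \<in> B" "u v \<noteq> 0" "(\<Sum>w\<in>B. rat_scale (u w) w) = 0"
    unfolding Qvec.dependent_finite[OF fin] by blast
  obtain D :: int where D: "D > 0" "\<And>w. w \<in> B \<Longrightarrow> of_int D * u w \<in> \<int>"
    using common_denominator[OF fin] by blast
  then have "\<forall>w\<in>B. \<exists>k. of_int D * u w = of_int k" by (auto elim: Ints_cases)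
  then obtain k where k: "\<And>w. w \<in> B \<Longrightarrow> of_int D * u w = of_int (k w)" by metis
  have "of_int (k w) = (of_int D * of_rat (u w) :: 'a)" if "w \<in> B" for w
    using arg_cong[OF k[OF that], of "of_rat :: rat \<Rightarrow> 'a"] by (simp add: of_rat_mult)
  then have "(\<Sum>w\<in>B. int_scale (k w) w) = of_int D * (\<Sum>w\<in>B. rat_scale (u w) w)"
    by (simp add: int_scale_def rat_scale_def sum_distrib_left mult.assoc)
  also have "\<dots> = 0" using uv(3) by simp
  finally have "k v = 0"
    using Zmod.independentD[OF ind fin subset_refl] uv(1) by blast
  then show False using k[OF uv(1)] D(1) uv(2) by simp
qed

section \<open>Coordinates and trace with respect to a rational basis\<close>

locale rational_basis =
  fixes B :: "'a::field_char_0 set"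
  assumes finite_B: "finite B"
    and independent_B: "Qvec.independent B"
    and span_B: "Qvec.span B = UNIV"
begin

abbreviation coord :: "'a \<Rightarrow> 'a \<Rightarrow> rat" where
  "coord \<equiv> Qvec.representation B"

lemma coord_add: "coord (x + y) b = coord x b + coord y b"
  by (simp add: Qvec.representation_add independent_B span_B)

lemma coord_scale: "coord (of_rat q * x) b = q * coord x b"
  using Qvec.representation_scale[OF independent_B, of x q] by (simp add: span_B rat_scale_def)

lemma coord_sum: "coord (sum f A) b = (\<Sum>i\<in>A. coord (f i) b)"
  by (simp add: Qvec.representation_sum independent_B span_B)

lemma coord_basis: "b \<in> B \<Longrightarrow> coord b c = (if c = b then 1 else 0)"
  by (simp add: Qvec.representation_basis independent_B)

lemma coord_expand: "(\<Sum>b\<in>B. of_rat (coord x b) * b) = x"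
  using Qvec.sum_representation_eq[OF independent_B _ finite_B subset_refl, of x]
  by (simp add: span_B rat_scale_def)

text \<open>The target is any field of characteristic zero because the expansion serves both the
  rational trace and a complex functional.\<close>

lemma linear_expand:
  fixes f :: "'a \<Rightarrow> 'b::field_char_0"
  assumes "\<And>x y. f (x + y) = f x + f y" "\<And>q x. f (of_rat q * x) = of_rat q * f x"
  shows "f x = (\<Sum>b\<in>B. of_rat (coord x b) * f b)"
proof -
  have "f 0 = 0" using assms(2)[of 0 0] by simp
  then have "f (sum g A) = (\<Sum>i\<in>A. f (g i))" for g :: "'a \<Rightarrow> 'a" and A
    by (induction A rule: infinite_finite_induct) (auto simp: assms(1))
  then have "f (\<Sum>b\<in>B. of_rat (coord x b) * b) = (\<Sum>b\<in>B. of_rat (coord x b) * f b)"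
    by (simp add: assms(2))
  then show ?thesis by (simp add: coord_expand)
qed

lemma in_Zspan_iff: "x \<in> Zmod.span B \<longleftrightarrow> (\<forall>b\<in>B. coord x b \<in> \<int>)"
proof
  assume "x \<in> Zmod.span B"
  then obtain u where u: "x = (\<Sum>v\<in>B. int_scale (u v) v)"
    by (auto simp: Zmod.span_finite[OF finite_B])
  have "x = (\<Sum>v\<in>B. of_rat (of_int (u v)) * v)"
    by (simp add: u int_scale_def)
  then have "coord x b = (\<Sum>v\<in>B. of_int (u v) * coord v b)" for b
    by (simp only: coord_sum coord_scale)
  then show "\<forall>b\<in>B. coord x b \<in> \<int>"
    by (auto simp: coord_basis intro!: Ints_sum)
next
  assume "\<forall>b\<in>B. coord x b \<in> \<int>"
  then have "\<forall>b\<in>B. \<exists>k. coord x b = of_int k" by (auto elim: Ints_cases)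
  then obtain k where "\<And>b. b \<in> B \<Longrightarrow> coord x b = of_int (k b)" by metis
  then have "x = (\<Sum>b\<in>B. int_scale (k b) b)"
    using coord_expand[of x] by (simp add: int_scale_def)
  moreover have "(\<Sum>b\<in>B. int_scale (k b) b) \<in> Zmod.span B"
    by (intro Zmod.span_sum Zmod.span_scale Zmod.span_base)
  ultimately show "x \<in> Zmod.span B" by simp
qed

text \<open>The trace of multiplication by \<open>x\<close> as a rational linear map, read off its
  matrix in the basis \<open>B\<close>.\<close>

definition trace :: "'a \<Rightarrow> rat" where
  "trace x = (\<Sum>b\<in>B. coord (x * b) b)"

lemma trace_add: "trace (x + y) = trace x + trace y"
  by (simp add: trace_def coord_add distrib_right sum.distrib)

lemma trace_scale: "trace (of_rat q * x) = q * trace x"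
  by (simp add: trace_def coord_scale mult.assoc sum_distrib_left)

lemma trace_1: "trace 1 = of_nat (card B)"
  by (simp add: trace_def coord_basis)

end

section \<open>Integrality of traces through complex eigenvalues\<close>

lemma sum_diag_mult_comm:
  fixes A C :: "'b::comm_semiring_1 mat"
  assumes "A \<in> carrier_mat n n" "C \<in> carrier_mat n n"
  shows "(\<Sum>i<n. (A * C) $$ (i, i)) = (\<Sum>i<n. (C * A) $$ (i, i))"
proof -
  have "(\<Sum>i<n. (A * C) $$ (i, i)) = (\<Sum>i<n. \<Sum>j<n. A $$ (i, j) * C $$ (j, i))"
    using assms by (simp add: scalar_prod_def atLeast0LessThan)
  also have "\<dots> = (\<Sum>j<n. \<Sum>i<n. C $$ (j, i) * A $$ (i, j))"
    by (subst sum.swap) (simp add: mult.commute)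
  also have "\<dots> = (\<Sum>i<n. (C * A) $$ (i, i))"
    using assms by (simp add: scalar_prod_def atLeast0LessThan)
  finally show ?thesis .
qed

text \<open>Schur decomposition makes \<open>A\<close> similar to a triangular matrix whose diagonal
  lists the roots of the characteristic polynomial, and similarity preserves the trace.\<close>

lemma sum_diag_eq_sum_eigenvalues:
  fixes A :: "complex mat"
  assumes A: "A \<in> carrier_mat n n"
  obtains es where "\<And>e. e \<in> set es \<Longrightarrow> eigenvalue A e" "(\<Sum>i<n. A $$ (i, i)) = sum_list es"
proof -
  obtain es where es: "char_poly A = (\<Prod>e\<leftarrow>es. [:- e, 1:])"
    using char_poly_factorized[OF A] by blast
  obtain C P Q where schur: "schur_decomposition A es = (C, P, Q)" by (metis surj_pair)
  have wit: "similar_mat_wit A C P Q" and diag: "diag_mat C = es"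
    using schur_decomposition[OF A es schur] by auto
  note mats = similar_mat_witD2[OF A wit]
  have "(\<Sum>i<n. A $$ (i, i)) = (\<Sum>i<n. (P * C * Q) $$ (i, i))"
    using mats by simp
  also have "\<dots> = (\<Sum>i<n. (Q * (P * C)) $$ (i, i))"
    using mats by (intro sum_diag_mult_comm) auto
  also have "Q * (P * C) = Q * P * C"
    using mats by (intro assoc_mult_mat[symmetric]) auto
  also have "\<dots> = C" using mats by simp
  also have "(\<Sum>i<n. C $$ (i, i)) = sum_list (diag_mat C)"
    using mats by (simp add: diag_mat_def interv_sum_list_conv_sum_set_nat atLeast0LessThan)
  finally have "(\<Sum>i<n. A $$ (i, i)) = sum_list es" by (simp add: diag)
  moreover have "eigenvalue A e" if "e \<in> set es" for e
  proof -
    have "poly (char_poly A) e = 0"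
      using that by (simp add: es poly_prod_list prod_list_zero_iff o_def)
    then show ?thesis using eigenvalue_root_char_poly[OF A] by simp
  qed
  ultimately show ?thesis using that by blast
qed

context rational_basis
begin

text \<open>Matrices are indexed by numbers, so the basis is listed. It is nonempty since the span
  of the empty set is \<open>{0}\<close>, which misses 1.\<close>

lemma ex_enumeration:
  obtains bs n where "set bs = B" "length bs = n" "n > 0" "\<And>i. i < n \<Longrightarrow> bs ! i \<in> B"
    "\<And>i j. i < n \<Longrightarrow> j < n \<Longrightarrow> bs ! i = bs ! j \<longleftrightarrow> i = j"
    "\<And>f :: 'a \<Rightarrow> 'b::comm_monoid_add. sum f B = (\<Sum>i<n. f (bs ! i))"
proof -
  obtain bs where bs: "set bs = B" "distinct bs"
    using finite_B finite_distinct_list by blast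
  have "sum f B = (\<Sum>i<length bs. f (bs ! i))" for f :: "'a \<Rightarrow> 'b"
    using sum.reindex_bij_betw[OF bij_betw_nth[OF bs(2) refl refl], of f] by (simp add: bs(1))
  moreover have "length bs > 0"
  proof -
    have "B \<noteq> {}"
    proof
      assume "B = {}"
      then have "(1::'a) \<in> {0}" using span_B Qvec.span_empty by (metis UNIV_I)
      then show False by simp
    qed
    then show ?thesis using bs(1) by auto
  qed
  ultimately show ?thesis
    using bs nth_mem[of _ bs] that[of bs "length bs"] by (simp add: nth_eq_iff_index_eq)
qed

text \<open>A left eigenvector of multiplication by \<open>x\<close> is a rational linear functional \<open>\<psi>\<close> with
  \<open>\<psi> (x * y) = e * \<psi> y\<close>, so every integral equation of \<open>x\<close> is one of the eigenvalue \<open>e\<close>.\<close>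

lemma trace_in_Ints:
  assumes x: "algebraic_int x"
  shows "trace x \<in> \<int>"
proof -
  obtain bs n where bs: "set bs = B" "length bs = n" "\<And>i. i < n \<Longrightarrow> bs ! i \<in> B"
    "\<And>i j. i < n \<Longrightarrow> j < n \<Longrightarrow> bs ! i = bs ! j \<longleftrightarrow> i = j"
    and sum_B: "\<And>f :: 'a \<Rightarrow> complex. sum f B = (\<Sum>i<n. f (bs ! i))"
    using ex_enumeration by metis
  \<comment> \<open>Row \<open>j\<close> holds the coordinates of \<open>x * bs ! j\<close>. This is
    the transpose of the usual matrix of multiplication by \<open>x\<close>, so its right
    eigenvectors are the functionals sought.\<close>
  define A where "A = mat n n (\<lambda>(j, i). of_rat (coord (x * bs ! j) (bs ! i)) :: complex)"
  have A: "A \<in> carrier_mat n n" by (simp add: A_def)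
  have "algebraic_int e" if e: "eigenvalue A e" for e
  proof -
    obtain v where v: "v \<in> carrier_vec n" "v \<noteq> 0\<^sub>v n" "A *\<^sub>v v = e \<cdot>\<^sub>v v"
      using e by (auto simp: eigenvalue_def eigenvector_def carrier_matD(1)[OF A])
    define \<psi> where "\<psi> y = (\<Sum>i<n. of_rat (coord y (bs ! i)) * v $ i)" for y
    have add: "\<psi> (y + z) = \<psi> y + \<psi> z" for y z
      by (simp add: \<psi>_def coord_add of_rat_add distrib_right sum.distrib)
    have scale: "\<psi> (of_rat q * y) = of_rat q * \<psi> y" for q y
      by (simp add: \<psi>_def coord_scale of_rat_mult sum_distrib_left mult.assoc)
    have basis: "\<psi> (bs ! j) = v $ j" if "j < n" for j
    proof -
      have "\<psi> (bs ! j) = (\<Sum>i<n. if i = j then v $ i else 0)"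
        unfolding \<psi>_def by (rule sum.cong) (auto simp: coord_basis bs that)
      then show ?thesis using that by simp
    qed
    have x_basis: "\<psi> (x * bs ! j) = e * \<psi> (bs ! j)" if "j < n" for j
    proof -
      have "\<psi> (x * bs ! j) = (A *\<^sub>v v) $ j"
        using that v(1) by (simp add: A_def \<psi>_def scalar_prod_def atLeast0LessThan)
      then show ?thesis using that v(1,3) basis by simp
    qed
    have mult: "\<psi> (x * y) = e * \<psi> y" for y
    proof -
      have "\<psi> (x * y) = (\<Sum>b\<in>B. of_rat (coord y b) * \<psi> (x * b))"
        using scale[of _ "x * _"] by (intro linear_expand) (simp_all add: distrib_left add mult.left_commute)
      also have "\<dots> = (\<Sum>b\<in>B. of_rat (coord y b) * (e * \<psi> b))"
        using x_basis bs(1,2) by (intro sum.cong) (auto simp: in_set_conv_nth)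
      also have "\<dots> = e * \<psi> y"
        using linear_expand[of \<psi> y] add scale by (simp add: sum_distrib_left mult.left_commute)
      finally show ?thesis .
    qed
    have poly: "\<psi> (poly (map_poly of_int p) x * y) = poly (map_poly of_int p) e * \<psi> y" for p y
    proof (induction p)
      case 0
      show ?case using scale[of 0 0] by simp
    next
      case (pCons c p)
      have "poly (map_poly of_int (pCons c p)) x * y
        = of_rat (of_int c) * y + x * (poly (map_poly of_int p) x * y)"
        by (simp add: of_int_hom.map_poly_pCons_hom distrib_right mult.assoc)
      then show ?case
        by (simp only: add scale mult pCons.IH) (simp add: of_int_hom.map_poly_pCons_hom distrib_right mult.assoc)
    qed
    obtain p where p: "poly (map_poly of_int p) x = 0" "lead_coeff p = 1"
      using x unfolding algebraic_int_altdef_ipoly by blast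
    obtain j where j: "j < n" "v $ j \<noteq> 0"
      using v(1,2) by (metis carrier_vecD eq_vecI index_zero_vec)
    have "poly (map_poly of_int p) e * \<psi> (bs ! j) = \<psi> 0"
      using poly[of p "bs ! j"] p(1) by simp
    then have "poly (map_poly of_int p) e = 0"
      using scale[of 0 0] basis j by simp
    then show ?thesis using p(2) unfolding algebraic_int_altdef_ipoly by blast
  qed
  moreover obtain es where es: "\<And>e. e \<in> set es \<Longrightarrow> eigenvalue A e"
    "(\<Sum>i<n. A $$ (i, i)) = sum_list es"
    using sum_diag_eq_sum_eigenvalues[OF A] by blast
  ultimately have "\<And>e. e \<in> set es \<Longrightarrow> algebraic_int e" by blast
  then have "algebraic_int (sum_list es)"
    by (induction es) (auto intro: algebraic_int_add)
  \<comment> \<open>The trace is now both rational and a sum of algebraic integers, hence an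
    integer.\<close>
  moreover have "(of_rat (trace x) :: complex) = sum_list es"
    using es(2) by (simp add: trace_def of_rat_sum sum_B A_def)
  ultimately have "of_rat (trace x) \<in> (\<int> :: complex set)"
    by (metis Rats_of_rat rational_algebraic_int_is_int)
  then obtain k where "of_rat (trace x) = (of_rat (of_int k) :: complex)"
    by (auto elim: Ints_cases)
  then show ?thesis by (simp only: of_rat_eq_iff) simp
qed

text \<open>The Gram matrix \<open>T\<close> of the trace form is integral and nonsingular. For
  integral \<open>x\<close> it sends the coordinate vector of \<open>x\<close> to a vector of
  integral traces, so by the adjugate matrix \<open>det T\<close> clears the denominators of every
  coordinate, uniformly in \<open>x\<close>.\<close>

lemma bounded_denominators:
  assumes B: "B \<subseteq> \<O>\<^sub>K"
  obtains d :: int where "d \<noteq> 0" "\<And>x b. x \<in> \<O>\<^sub>K \<Longrightarrow> b \<in> B \<Longrightarrow> of_int d * coord x b \<in> \<int>"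
proof -
  obtain bs n where bs: "set bs = B" "length bs = n" "n > 0" "\<And>i. i < n \<Longrightarrow> bs ! i \<in> B"
    "\<And>i j. i < n \<Longrightarrow> j < n \<Longrightarrow> bs ! i = bs ! j \<longleftrightarrow> i = j"
    and sum_B: "\<And>f :: 'a \<Rightarrow> rat. sum f B = (\<Sum>i<n. f (bs ! i))"
    using ex_enumeration by metis
  have "\<exists>k. trace (bs ! i * bs ! j) = of_int k" if "i < n" "j < n" for i j
    using trace_in_Ints[of "bs ! i * bs ! j"] B bs(4) that
    by (auto simp: ring_of_integers_def intro!: algebraic_int_mult elim!: Ints_cases)
  then obtain t where t: "\<And>i j. i < n \<Longrightarrow> j < n \<Longrightarrow> trace (bs ! i * bs ! j) = of_int (t i j)"
    by metis
  define T where "T = mat n n (\<lambda>(i, j). t i j)"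
  define T' where "T' = map_mat rat_of_int T"
  have T: "T \<in> carrier_mat n n" and T': "T' \<in> carrier_mat n n" by (simp_all add: T_def T'_def)
  have T'v: "(T' *\<^sub>v v) $ i = (\<Sum>j<n. trace (bs ! i * bs ! j) * v $ j)"
    if "i < n" "v \<in> carrier_vec n" for v i
    using that t by (simp add: T'_def T_def scalar_prod_def atLeast0LessThan)
  have expand: "trace (z * y) = (\<Sum>j<n. trace (z * bs ! j) * coord y (bs ! j))" for y z
  proof -
    have "trace (z * y) = (\<Sum>b\<in>B. of_rat (coord y b) * trace (z * b))"
      using trace_scale[of _ "z * _"]
      by (intro linear_expand) (simp_all add: distrib_left trace_add mult.left_commute)
    then show ?thesis by (simp add: sum_B mult.commute)
  qed
  \<comment> \<open>A kernel vector would be the coordinate vector of a nonzero \<open>y\<close>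
    orthogonal to the whole field, in particular to its inverse; but the trace of 1 is
    \<open>card B\<close>, which is nonzero.\<close>
  have "det T' \<noteq> 0"
  proof
    assume "det T' = 0"
    then obtain v where v: "v \<in> carrier_vec n" "v \<noteq> 0\<^sub>v n" "T' *\<^sub>v v = 0\<^sub>v n"
      using det_0_iff_vec_prod_zero_field[OF T'] by blast
    define y where "y = (\<Sum>j<n. of_rat (v $ j) * bs ! j)"
    have coord_y: "coord y (bs ! j) = v $ j" if "j < n" for j
    proof -
      have "coord y (bs ! j) = (\<Sum>i<n. if i = j then v $ i else 0)"
        unfolding y_def coord_sum coord_scale
        by (rule sum.cong) (auto simp: coord_basis bs that)
      then show ?thesis using that by simp
    qed
    have "trace (bs ! i * y) = 0" if "i < n" for i
      using T'v[OF that v(1)] v(3) that by (simp add: expand[where y = y] coord_y)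
    then have "trace (y * z) = 0" for z
      using expand[where y = z and z = y] by (simp add: mult.commute)
    moreover have "y \<noteq> 0"
    proof
      assume "y = 0"
      then have "v $ j = 0" if "j < n" for j
        using coord_y[OF that] by (simp add: Qvec.representation_zero)
      then show False using v(1,2) by auto
    qed
    ultimately have "trace 1 = 0" by (metis right_inverse)
    then show False
      using trace_1 finite_B bs(1,2,3) by auto
  qed
  then have "det T \<noteq> 0" by (simp add: T'_def)
  moreover have "of_int (det T) * coord x b \<in> \<int>" if x: "x \<in> \<O>\<^sub>K" and b: "b \<in> B" for x b
  proof -
    obtain j where j: "j < n" "bs ! j = b" using b bs(1,2) by (auto simp: in_set_conv_nth)
    define a where "a = vec n (\<lambda>j. coord x (bs ! j))"
    have a: "a \<in> carrier_vec n" by (simp add: a_def)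
    define U where "U = map_mat rat_of_int (adj_mat T)"
    have U: "U \<in> carrier_mat n n" using adj_mat(1)[OF T] by (simp add: U_def)
    have "U * T' = map_mat rat_of_int (adj_mat T * T)"
      unfolding U_def T'_def by (rule of_int_hom.mat_hom_mult[symmetric, OF adj_mat(1)[OF T] T])
    also have "\<dots> = of_int (det T) \<cdot>\<^sub>m 1\<^sub>m n"
      unfolding adj_mat(3)[OF T] by (rule eq_matI) auto
    finally have "U *\<^sub>v (T' *\<^sub>v a) = (of_int (det T) \<cdot>\<^sub>m 1\<^sub>m n) *\<^sub>v a"
      using assoc_mult_mat_vec[OF U T' a] by simp
    also have "\<dots> = of_int (det T) \<cdot>\<^sub>v a"
      using a by (intro eq_vecI) (auto simp: row_smult)
    finally have "U *\<^sub>v (T' *\<^sub>v a) = of_int (det T) \<cdot>\<^sub>v a" .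
    then have "of_int (det T) * coord x b = (U *\<^sub>v (T' *\<^sub>v a)) $ j"
      using j by (simp add: a_def)
    also have "\<dots> = (\<Sum>i<n. U $$ (j, i) * (T' *\<^sub>v a) $ i)"
      using j U T' by (simp add: scalar_prod_def atLeast0LessThan)
    also have "\<dots> = (\<Sum>i<n. U $$ (j, i) * trace (bs ! i * x))"
      using T'v a by (simp add: expand[where y = x] a_def)
    also have "\<dots> \<in> \<int>"
    proof (intro Ints_sum Ints_mult)
      fix i assume "i \<in> {..<n}"
      then have i: "i < n" by simp
      show "U $$ (j, i) \<in> \<int>" using i j adj_mat(1)[OF T] by (simp add: U_def)
      show "trace (bs ! i * x) \<in> \<int>"
        using x B bs(4)[OF i] by (intro trace_in_Ints algebraic_int_mult) (auto simp: ring_of_integers_def)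
    qed
    finally show ?thesis .
  qed
  ultimately show ?thesis using that by blast
qed

end

section \<open>Bases of orders and the multiplier of the ring of integers\<close>

text \<open>An integral basis of the order is independent over the rationals, and its cardinality is
  the degree, so extending it to a rational basis adds nothing.\<close>

lemma order_basis:
  fixes R :: "'a::field_char_0 set"
  assumes "is_number_field TYPE('a)" "is_order R"
  obtains B where "rational_basis B" "R = Zmod.span B"
proof -
  obtain B0 :: "'a set" where B0: "finite B0" "Qvec.span B0 = UNIV"
    using assms(1) by (auto simp: is_number_field_def)
  obtain B where B: "finite B" "Zmod.independent B" "Zmod.span B = R"
    "card B = Qvec.dim (UNIV :: 'a set)"
    using assms(2) by (auto simp: is_order_def)
  have ind: "Qvec.independent B" by (rule independent_over_rationals[OF B(1,2)])
  let ?E = "Qvec.extend_basis B"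
  note E = Qvec.extend_basis_superset[OF ind] Qvec.independent_extend_basis[OF ind]
    Qvec.span_extend_basis[OF ind]
  have "finite ?E"
    using Qvec.independent_span_bound[OF B0(1) E(2)] B0(2) by simp
  moreover have "card ?E = card B"
    using Qvec.basis_card_eq_dim[of ?E UNIV] E B(4) by simp
  ultimately have "?E = B" using E(1) by (metis card_subset_eq)
  then show ?thesis
    using that[of B] B(1,3) ind E(3) by (simp add: rational_basis_def)
qed

text \<open>Guarantees that the minimum in \<open>least_mult R\<close> is attained: the common
  denominator of all coordinates of integral elements is a multiplier.\<close>

lemma ex_multiplier:
  fixes R :: "'a::field_char_0 set"
  assumes "is_number_field TYPE('a)" "is_order R"
  shows "\<exists>m>0. of_nat m *o \<O>\<^sub>K \<subseteq> R"
proof -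
  obtain B where "rational_basis B" and R: "R = Zmod.span B"
    using order_basis[OF assms] by blast
  interpret rational_basis B by fact
  have "B \<subseteq> \<O>\<^sub>K"
    using assms(2) R Zmod.span_superset[of B] by (auto simp: is_order_def)
  then obtain d :: int where d: "d \<noteq> 0"
    "\<And>x b. x \<in> \<O>\<^sub>K \<Longrightarrow> b \<in> B \<Longrightarrow> of_int d * coord x b \<in> \<int>"
    using bounded_denominators by blast
  have "of_nat (nat \<bar>d\<bar>) *o \<O>\<^sub>K \<subseteq> R"
  proof
    fix y :: 'a assume "y \<in> of_nat (nat \<bar>d\<bar>) *o \<O>\<^sub>K"
    then obtain x where x: "x \<in> \<O>\<^sub>K" "y = of_rat (of_int \<bar>d\<bar>) * x"
      by (auto simp: elt_set_times_def of_nat_nat simp del: of_int_abs)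
    have "coord y b \<in> \<int>" if "b \<in> B" for b
    proof -
      have "of_int \<bar>d\<bar> * coord x b = of_int d * coord x b
        \<or> of_int \<bar>d\<bar> * coord x b = - (of_int d * coord x b)"
        by (cases "d \<ge> 0") auto
      then show ?thesis
        using d(2)[OF x(1) that] unfolding x(2) coord_scale by (metis Ints_minus)
    qed
    then show "y \<in> R" by (simp add: R in_Zspan_iff)
  qed
  then show ?thesis using d(1) by (metis zero_less_abs_iff zero_less_nat_eq)
qed

section \<open>The covering of the ring of integers\<close>

lemma mem_scale_iff: "a \<noteq> 0 \<Longrightarrow> x \<in> a *o S \<longleftrightarrow> x / a \<in> S" for a :: "'a::field"
  by (auto simp: elt_set_times_def intro!: bexI[of _ "x / a"])

lemma scale_subset_iff: "a *o S \<subseteq> T \<longleftrightarrow> (\<forall>x\<in>S. a * x \<in> T)"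
  by (auto simp: elt_set_times_def)

lemma mem_conductor_iff: "x \<in> conductor R \<longleftrightarrow> (\<forall>y\<in>\<O>\<^sub>K. x * y \<in> R)"
  by (simp add: conductor_def scale_subset_iff)

section \<open>Subrings, cofactors and least multiples\<close>

locale ring_set =
  fixes R :: "'a::field_char_0 set"
  assumes subring: "is_subring R"
begin

lemma zero: "0 \<in> R" and one: "1 \<in> R"
  and neg: "x \<in> R \<Longrightarrow> - x \<in> R"
  and add: "x \<in> R \<Longrightarrow> y \<in> R \<Longrightarrow> x + y \<in> R"
  and mult: "x \<in> R \<Longrightarrow> y \<in> R \<Longrightarrow> x * y \<in> R"
  using subring by (auto simp: is_subring_def)

lemma diff: "x \<in> R \<Longrightarrow> y \<in> R \<Longrightarrow> x - y \<in> R"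
  using add[OF _ neg] by simp

lemmas of_nat = of_nat_in_subring[OF subring]

lemmas closed = zero one neg add mult diff of_nat

end

interpretation OK: ring_set "\<O>\<^sub>K :: 'a::field_char_0 set"
  by unfold_locales (rule is_subring_ring_of_integers)

text \<open>A rational algebraic integer is an integer.\<close>

lemma of_nat_div_in_ring_of_integers:
  assumes "of_nat k / of_nat l \<in> (\<O>\<^sub>K :: 'a::field_char_0 set)" "l > 0"
  shows "l dvd k"
proof -
  have "of_nat k / of_nat l \<in> (\<int> :: 'a set)"
    using assms(1) by (intro rational_algebraic_int_is_int) (auto simp: ring_of_integers_def)
  then obtain z where "of_nat k / of_nat l = (of_int z :: 'a)" by (auto elim: Ints_cases)
  then have "of_int (int k) = (of_int (int l * z) :: 'a)"
    using assms(2) by (simp add: field_simps)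
  then have "int l dvd int k" by (simp only: of_int_eq_iff) simp
  then show ?thesis by simp
qed

text \<open>The ideal generated by \<open>n\<close> lies in the one generated by \<open>h\<close>
  exactly if \<open>n / h\<close> is integral. Some positive \<open>n\<close> has this property, by
  way of a constant coefficient, so the minimum defining \<open>least_mult\<close> is attained and
  yields all five facts.\<close>

lemma
  fixes h :: "'a::field_char_0"
  assumes "h \<in> \<O>\<^sub>K" "h \<noteq> 0"
  shows cofactor_nonzero: "cofactor h \<noteq> 0"
    and cofactor_integral: "cofactor h \<in> \<O>\<^sub>K"
    and cofactor_mult: "cofactor h * h = of_nat (least_mult (h *o \<O>\<^sub>K))"
    and least_mult_principal_pos: "least_mult (h *o \<O>\<^sub>K) > 0"
    and least_mult_principal_le:
      "\<And>k. k > 0 \<Longrightarrow> of_nat k / h \<in> \<O>\<^sub>K \<Longrightarrow> least_mult (h *o \<O>\<^sub>K) \<le> k"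
proof -
  let ?P = "\<lambda>m. 0 < m \<and> of_nat m *o \<O>\<^sub>K \<subseteq> h *o \<O>\<^sub>K"
  have P: "?P k \<longleftrightarrow> 0 < k \<and> of_nat k / h \<in> \<O>\<^sub>K" for k
    using assms(2) OK.one OK.mult[of "of_nat k / h"]
    by (fastforce simp: scale_subset_iff mem_scale_iff)
  obtain k where "?P k"
    using algebraic_int_divides_nat[of h] assms unfolding P by (auto simp: ring_of_integers_def)
  then have least: "?P (least_mult (h *o \<O>\<^sub>K))"
    unfolding least_mult_def by (rule LeastI)
  then show "least_mult (h *o \<O>\<^sub>K) > 0" by blast
  with assms(2) show "cofactor h \<noteq> 0" by (simp add: cofactor_def)
  show "cofactor h \<in> \<O>\<^sub>K" using least unfolding P cofactor_def by blast
  show "cofactor h * h = of_nat (least_mult (h *o \<O>\<^sub>K))"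
    using assms(2) by (simp add: cofactor_def)
  show "least_mult (h *o \<O>\<^sub>K) \<le> k" if "k > 0" "of_nat k / h \<in> \<O>\<^sub>K" for k
    unfolding least_mult_def by (rule Least_le) (use P that in blast)
qed

locale nonmaximal_order = ring_set R for R :: "'a::field_char_0 set" +
  assumes number_field: "is_number_field TYPE('a)"
    and nonmaximal: "is_nonmaximal_order R"
begin

lemma order: "is_order R" and not_maximal: "R \<noteq> \<O>\<^sub>K" and integral: "x \<in> R \<Longrightarrow> x \<in> \<O>\<^sub>K"
  using nonmaximal by (auto simp: is_nonmaximal_order_def is_order_def)

definition m :: nat where "m = least_mult R"

lemma m_pos: "m > 0" and m_mult: "x \<in> \<O>\<^sub>K \<Longrightarrow> of_nat m * x \<in> R"
proof -
  have "0 < m \<and> of_nat m *o \<O>\<^sub>K \<subseteq> R"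
    unfolding m_def least_mult_def using ex_multiplier[OF number_field order] by (rule LeastI_ex)
  then show "m > 0" "x \<in> \<O>\<^sub>K \<Longrightarrow> of_nat m * x \<in> R"
    by (auto simp: scale_subset_iff)
qed

text \<open>The remainder of \<open>k\<close> modulo \<open>m\<close> is again a multiplier into
  \<open>R\<close>, so the minimality of \<open>m\<close> forces it to be zero.\<close>

lemma m_dvd:
  assumes "\<And>x. x \<in> \<O>\<^sub>K \<Longrightarrow> of_nat k * x \<in> R"
  shows "m dvd k"
proof (rule ccontr)
  assume "\<not> m dvd k"
  then have pos: "k mod m > 0" by (simp add: dvd_eq_mod_eq_0)
  have "of_nat (k mod m) * x \<in> R" if "x \<in> \<O>\<^sub>K" for x
  proof -
    have "of_nat k = (of_nat m * of_nat (k div m) + of_nat (k mod m) :: 'a)"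
      by (metis mult_div_mod_eq of_nat_add of_nat_mult)
    then have "of_nat (k mod m) * x = of_nat k * x - of_nat m * (of_nat (k div m) * x)"
      by (simp add: algebra_simps)
    also have "\<dots> \<in> R"
      using that by (intro diff assms m_mult OK.mult OK.of_nat)
    finally show ?thesis .
  qed
  then have "m \<le> k mod m"
    unfolding m_def least_mult_def using pos
    by (intro Least_le) (auto simp: scale_subset_iff m_def least_mult_def)
  then show False using m_pos by (meson leD mod_less_divisor)
qed

text \<open>If \<open>m\<close> were 1, then \<open>\<O>\<^sub>K\<close> would lie in
  \<open>R\<close>. This is where nonmaximality enters.\<close>

lemma m_neq_1: "m \<noteq> 1"
  using m_mult integral not_maximal by fastforce

lemma one_notin_m: "1 \<notin> of_nat m *o \<O>\<^sub>K"
  using of_nat_div_in_ring_of_integers[of 1 m] m_pos m_neq_1 by (auto simp: mem_scale_iff)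

text \<open>For integral \<open>x\<close>, the least multiple times \<open>x\<close> equals
  \<open>cofactor h * (h * x)\<close>, which lies in \<open>R\<close> by the definition of the
  conductor.\<close>

lemma m_dvd_least_mult:
  assumes "h \<in> \<O>\<^sub>K" "h \<noteq> 0" "cofactor h \<in> conductor R"
  shows "m dvd least_mult (h *o \<O>\<^sub>K)"
proof (rule m_dvd)
  fix x :: 'a assume "x \<in> \<O>\<^sub>K"
  then have "cofactor h * (h * x) \<in> R"
    using assms by (simp add: mem_conductor_iff OK.mult)
  then show "of_nat (least_mult (h *o \<O>\<^sub>K)) * x \<in> R"
    using cofactor_mult[OF assms(1,2)] by (simp add: mult.assoc[symmetric])
qed

section \<open>The ideals of the covering\<close>

lemma mem_covering_ideal_iff:
  assumes "h \<in> \<O>\<^sub>K" "h \<noteq> 0"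
  shows "x \<in> covering_ideal R h \<longleftrightarrow> x \<in> \<O>\<^sub>K \<and>
    (if cofactor h \<in> conductor R then cofactor h * x / of_nat m \<in> R else cofactor h * x \<in> R)"
  using cofactor_nonzero[OF assms] m_pos
  by (auto simp: covering_ideal_def mem_scale_iff m_def[symmetric] mult.commute)

text \<open>If \<open>cofactor h\<close> is in the conductor, the factor \<open>m\<close> cancels
  and the conductor property remains; otherwise \<open>m\<close> carries the integral element
  \<open>cofactor h * z\<close> into \<open>R\<close>.\<close>

lemma multiple_in_covering_ideal:
  assumes h: "h \<in> \<O>\<^sub>K" "h \<noteq> 0" and z: "z \<in> \<O>\<^sub>K"
  shows "of_nat m * z \<in> covering_ideal R h"
proof (cases "cofactor h \<in> conductor R")
  case True
  then have "cofactor h * z \<in> R" using z by (simp add: mem_conductor_iff)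
  then show ?thesis
    using True m_pos z by (simp add: mem_covering_ideal_iff[OF h] OK.closed)
next
  case False
  have "of_nat m * (cofactor h * z) \<in> R"
    using z by (intro m_mult OK.mult cofactor_integral h)
  then show ?thesis
    using False z by (simp add: mem_covering_ideal_iff[OF h] OK.closed mult.left_commute)
qed

lemma covering_ideal_add:
  assumes h: "h \<in> \<O>\<^sub>K" "h \<noteq> 0" and "x \<in> covering_ideal R h" "y \<in> covering_ideal R h"
  shows "x + y \<in> covering_ideal R h"
  using assms(3,4)
  by (auto simp: mem_covering_ideal_iff[OF h] OK.add distrib_left add_divide_distrib intro: add split: if_splits)

text \<open>The product \<open>cofactor h * h\<close> is a natural number, and in the conductor case
  it stays one after division by \<open>m\<close>.\<close>

lemma self_in_covering_ideal:
  assumes h: "h \<in> \<O>\<^sub>K" "h \<noteq> 0"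
  shows "h \<in> covering_ideal R h"
proof (cases "cofactor h \<in> conductor R")
  case True
  then obtain k where "least_mult (h *o \<O>\<^sub>K) = m * k"
    using m_dvd_least_mult[OF h] by (auto elim: dvdE)
  then have "cofactor h * h / of_nat m = of_nat k"
    using m_pos by (simp add: cofactor_mult[OF h])
  then show ?thesis
    using True h of_nat by (simp add: mem_covering_ideal_iff[OF h])
qed (use h of_nat in \<open>simp add: mem_covering_ideal_iff[OF h] cofactor_mult[OF h]\<close>)

lemma coset_subset_covering_ideal:
  assumes h: "h \<in> \<O>\<^sub>K" "h \<noteq> 0"
  shows "h +o (of_nat m *o \<O>\<^sub>K) \<subseteq> covering_ideal R h"
  using covering_ideal_add[OF h self_in_covering_ideal[OF h]] multiple_in_covering_ideal[OF h]
  by (auto simp: elt_set_plus_def elt_set_times_def)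

lemma covering_ideal_proper:
  assumes h: "h \<in> \<O>\<^sub>K" "h \<noteq> 0"
  shows "covering_ideal R h \<subset> \<O>\<^sub>K"
proof -
  have "covering_ideal R h \<noteq> \<O>\<^sub>K"
  proof
    assume eq: "covering_ideal R h = \<O>\<^sub>K"
    show False
    proof (cases "cofactor h \<in> conductor R")
      case True
      obtain k where k: "least_mult (h *o \<O>\<^sub>K) = m * k"
        using m_dvd_least_mult[OF h True] by (auto elim: dvdE)
      \<comment> \<open>Membership of 1 already gives a contradiction: it makes
        \<open>of_nat k / h\<close> integral, although \<open>k\<close> is smaller than the least
        multiple \<open>m * k\<close>.\<close>
      have "cofactor h / of_nat m \<in> R"
        using eq OK.one True mem_covering_ideal_iff[OF h, of 1] by auto
      moreover have "cofactor h / of_nat m = of_nat k / h"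
        using cofactor_mult[OF h] h(2) m_pos by (simp add: k field_simps)
      ultimately have "of_nat k / h \<in> \<O>\<^sub>K" by (simp add: integral)
      moreover have "k > 0" using k least_mult_principal_pos[OF h] by (intro Nat.gr0I) auto
      ultimately have "m * k \<le> k" using least_mult_principal_le[OF h] k by metis
      then show False using \<open>k > 0\<close> m_pos m_neq_1 by simp
    next
      case False
      \<comment> \<open>Equality with \<open>\<O>\<^sub>K\<close> would put
        \<open>cofactor h\<close> into the conductor.\<close>
      have "cofactor h * x \<in> R" if "x \<in> \<O>\<^sub>K" for x
        using that eq False mem_covering_ideal_iff[OF h, of x] by auto
      then show False using False by (simp add: mem_conductor_iff)
    qed
  qed
  then show ?thesis by (auto simp: mem_covering_ideal_iff[OF h])
qed

text \<open>The common denominator is \<open>m\<close>, since the ideal consists of integral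
  elements.\<close>

lemma covering_ideal_fractional:
  assumes h: "h \<in> \<O>\<^sub>K" "h \<noteq> 0"
  shows "is_fractional_ideal R (covering_ideal R h)"
proof -
  have "r * x \<in> covering_ideal R h" if "r \<in> R" "x \<in> covering_ideal R h" for r x
    using that mult[of r "cofactor h * x / of_nat m"] mult[of r "cofactor h * x"]
    by (auto simp: mem_covering_ideal_iff[OF h] OK.mult integral mult.left_commute split: if_splits)
  moreover have "of_nat m *o covering_ideal R h \<subseteq> R"
    using m_mult by (auto simp: scale_subset_iff mem_covering_ideal_iff[OF h])
  moreover have "0 \<in> covering_ideal R h"
    using multiple_in_covering_ideal[OF h OK.zero] by simp
  moreover have "covering_ideal R h \<noteq> {0}"
    using self_in_covering_ideal[OF h] h(2) by auto
  ultimately show ?thesis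
    using covering_ideal_add[OF h] of_nat m_pos unfolding is_fractional_ideal_def
    by (metis not_gr0 of_nat_eq_0_iff)
qed

text \<open>The coset of 0 is the one left out, so no representative is zero. The coset of 1 is
  nontrivial, so there is at least one representative.\<close>

lemma coset_reps:
  fixes H :: "'a set"
  assumes "is_nontrivial_coset_reps m H"
  shows coset_reps_integral: "h \<in> H \<Longrightarrow> h \<in> \<O>\<^sub>K"
    and coset_reps_nonzero: "h \<in> H \<Longrightarrow> h \<noteq> 0"
    and coset_reps_nonempty: "H \<noteq> {}"
    and coset_reps_cover: "x \<in> \<O>\<^sub>K \<Longrightarrow>
      x \<in> of_nat m *o \<O>\<^sub>K \<or> (\<exists>h\<in>H. x \<in> h +o (of_nat m *o \<O>\<^sub>K))"
proof -
  let ?M = "of_nat m *o \<O>\<^sub>K :: 'a set"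
  have H: "H \<subseteq> \<O>\<^sub>K" "bij_betw (\<lambda>h. h +o ?M) H ((\<lambda>x. x +o ?M) ` \<O>\<^sub>K - {?M})"
    using assms by (auto simp: is_nontrivial_coset_reps_def)
  have image: "(\<lambda>h. h +o ?M) ` H = (\<lambda>x. x +o ?M) ` \<O>\<^sub>K - {?M}"
    using H(2) by (simp add: bij_betw_def)
  show "h \<in> \<O>\<^sub>K" if "h \<in> H" using that H by blast
  show "h \<noteq> 0" if "h \<in> H" for h
  proof
    assume "h = 0"
    then have "?M \<in> (\<lambda>h. h +o ?M) ` H" using that by force
    then show False unfolding image by blast
  qed
  have self: "x \<in> x +o ?M" for x
    using OK.zero by (auto simp: elt_set_plus_def elt_set_times_def)
  show cover: "x \<in> ?M \<or> (\<exists>h\<in>H. x \<in> h +o ?M)" if "x \<in> \<O>\<^sub>K" for x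
  proof (cases "x +o ?M = ?M")
    case False
    with that have "x +o ?M \<in> (\<lambda>h. h +o ?M) ` H" unfolding image by blast
    then show ?thesis using self[of x] by auto
  qed (use self[of x] in auto)
  show "H \<noteq> {}" using cover[OF OK.one] one_notin_m by blast
qed

text \<open>Each nontrivial coset lies in the ideal of its representative, and the trivial coset
  lies in every one of these ideals, so a single \<open>h\<close> takes care of it.\<close>

lemma covering:
  fixes H :: "'a set"
  assumes H: "is_nontrivial_coset_reps m H"
  shows "\<O>\<^sub>K = (\<Union>h\<in>H. covering_ideal R h)"
proof
  note reps = coset_reps[OF H]
  show "(\<Union>h\<in>H. covering_ideal R h) \<subseteq> \<O>\<^sub>K"
    using covering_ideal_proper reps(1,2) by blast
  show "\<O>\<^sub>K \<subseteq> (\<Union>h\<in>H. covering_ideal R h)"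
  proof
    fix x :: 'a assume "x \<in> \<O>\<^sub>K"
    then consider "x \<in> of_nat m *o \<O>\<^sub>K" | h where "h \<in> H" "x \<in> h +o (of_nat m *o \<O>\<^sub>K)"
      using reps(4) by blast
    then show "x \<in> (\<Union>h\<in>H. covering_ideal R h)"
    proof cases
      case 1
      then obtain z where "z \<in> \<O>\<^sub>K" "x = of_nat m * z" by (auto simp: elt_set_times_def)
      moreover obtain h where "h \<in> H" using reps(3) by blast
      ultimately show ?thesis using multiple_in_covering_ideal[of h z] reps(1,2) by auto
    next
      case 2
      then show ?thesis using coset_subset_covering_ideal reps(1,2) by blast
    qed
  qed
qed

end

section \<open>Constructible right ideals of monoids with left fractions\<close>

lemma quotient_word_closed:
  fixes G (structure)
  assumes "group G" "P \<subseteq> carrier G" "set ps \<subseteq> P \<times> P"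
  shows "quotient_word G ps \<in> carrier G"
proof -
  interpret group G by fact
  show ?thesis using assms(3)
    by (induction ps) (use assms(2) in \<open>auto simp: subset_iff intro!: m_closed inv_closed\<close>)
qed

text \<open>Left fractions allow the successive prefix products to be prescribed freely. The
  parameter \<open>a\<close> is the previously reached element, and the next pair expresses the step
  from \<open>a\<close> to \<open>g\<close>.\<close>

lemma ex_quotient_word_prefixes:
  fixes G (structure)
  assumes G: "group G" and P: "P \<subseteq> carrier G"
    and frac: "\<And>g. g \<in> carrier G \<Longrightarrow> \<exists>p\<in>P. \<exists>q\<in>P. g = inv p \<otimes> q"
    and "set gs \<subseteq> carrier G" "a \<in> carrier G"
  shows "\<exists>ps. length ps = length gs \<and> set ps \<subseteq> P \<times> P \<and>
    (\<forall>j<length gs. a \<otimes> quotient_word G (take (Suc j) ps) = gs ! j)"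
  using assms(4,5)
proof (induction gs arbitrary: a)
  case (Cons g gs)
  interpret group G by fact
  have g: "g \<in> carrier G" and a: "a \<in> carrier G" using Cons.prems by auto
  obtain p q where pq: "p \<in> P" "q \<in> P" "inv a \<otimes> g = inv p \<otimes> q"
    using frac[of "inv a \<otimes> g"] a g by auto
  obtain ps where ps: "length ps = length gs" "set ps \<subseteq> P \<times> P"
    "\<And>j. j < length gs \<Longrightarrow> g \<otimes> quotient_word G (take (Suc j) ps) = gs ! j"
    using Cons.IH[of g] Cons.prems by auto
  have step: "a \<otimes> (inv p \<otimes> q \<otimes> w) = g \<otimes> w" if "w \<in> carrier G" for w
  proof -
    have "a \<otimes> (inv p \<otimes> q \<otimes> w) = (a \<otimes> (inv a \<otimes> g)) \<otimes> w"
      using that a g by (simp add: pq(3)[symmetric] m_assoc)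
    also have "a \<otimes> (inv a \<otimes> g) = g"
      using a g by (simp add: m_assoc[symmetric])
    finally show ?thesis .
  qed
  have "a \<otimes> quotient_word G (take (Suc j) ((p, q) # ps)) = (g # gs) ! j"
    if "j < length (g # gs)" for j
  proof (cases j)
    case 0
    then show ?thesis using step[OF one_closed] g by simp
  next
    case (Suc i)
    have "set (take (Suc i) ps) \<subseteq> P \<times> P"
      using ps(2) set_take_subset by fast
    then have "quotient_word G (take (Suc i) ps) \<in> carrier G"
      by (rule quotient_word_closed[OF G P])
    then show ?thesis using step ps(3)[of i] that Suc by simp
  qed
  then show ?case
    using pq(1,2) ps(1,2) by (intro exI[of _ "(p, q) # ps"]) auto
qed simp

text \<open>List the elements of \<open>A\<close> and realise them as the prefix products of a word
  starting at the identity.\<close>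

lemma Inter_cosets_constructible:
  fixes G (structure)
  assumes G: "group G" and P: "P \<subseteq> carrier G"
    and frac: "\<And>g. g \<in> carrier G \<Longrightarrow> \<exists>p\<in>P. \<exists>q\<in>P. g = inv p \<otimes> q"
    and A: "finite A" "A \<subseteq> carrier G"
  shows "P \<inter> (\<Inter>g\<in>A. g <# P) \<in> constructible_ideals G P"
proof -
  interpret group G by fact
  obtain gs where gs: "set gs = A" using finite_list[OF A(1)] by blast
  obtain ps where ps: "length ps = length gs" "set ps \<subseteq> P \<times> P"
    "\<And>j. j < length gs \<Longrightarrow> \<one> \<otimes> quotient_word G (take (Suc j) ps) = gs ! j"
    using ex_quotient_word_prefixes[OF G P frac, of gs \<one>] A(2) gs by auto
  have prefix: "quotient_word G (take (Suc j) ps) = gs ! j" if "j < length gs" for j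
  proof -
    have "set (take (Suc j) ps) \<subseteq> P \<times> P"
      using ps(2) set_take_subset by fast
    then have "quotient_word G (take (Suc j) ps) \<in> carrier G"
      by (rule quotient_word_closed[OF G P])
    then show ?thesis using ps(3)[OF that] by simp
  qed
  \<comment> \<open>Prefix lengths start at 1 whereas list positions start at 0.\<close>
  have "{1..length ps} = Suc ` {..<length gs}"
    using ps(1) by (metis One_nat_def image_Suc_lessThan)
  then have "(\<lambda>j. quotient_word G (take j ps)) ` {1..length ps} = (\<lambda>j. gs ! j) ` {..<length gs}"
    using prefix by (auto simp: image_image)
  also have "\<dots> = A" using gs by (auto simp: set_conv_nth)
  finally have image: "(\<lambda>j. quotient_word G (take j ps)) ` {1..length ps} = A" .
  have "P \<inter> (\<Inter>g\<in>A. g <# P) = constructible_ideal G P ps"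
    by (simp add: constructible_ideal_def flip: image)
  then show ?thesis using ps(2) by (auto simp: constructible_ideals_def)
qed

lemma not_independentI:
  assumes "\<Union>\<C> = X" "\<C> \<subseteq> constructible_ideals G P" "X \<notin> \<C>" "finite \<C>" "\<C> \<noteq> {}"
    "X \<in> constructible_ideals G P"
  shows "\<not> satisfies_independence G P"
  unfolding satisfies_independence_def
proof
  assume "\<forall>\<C>. finite \<C> \<and> \<C> \<noteq> {} \<and> \<C> \<subseteq> constructible_ideals G P \<and> \<Union>\<C> \<in> constructible_ideals G P
    \<longrightarrow> \<Union>\<C> \<in> \<C>"
  from spec[OF this, of \<C>] assms show False by simp
qed

lemma inv_affine_group:
  assumes "a \<noteq> 0"
  shows "inv\<^bsub>affine_group\<^esub> (0, a) = (0, 1 / a :: 'a::field)"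
  by (rule group.inv_equality[OF group_affine_group]) (use assms in \<open>auto simp: affine_group_def\<close>)

lemma inv_mult_group:
  assumes "a \<noteq> 0"
  shows "inv\<^bsub>mult_group\<^esub> a = (1 / a :: 'a::field)"
  by (rule group.inv_equality[OF group_mult_group]) (use assms in \<open>auto simp: mult_group_def\<close>)

section \<open>Constructible ideals from principal fractional ideals\<close>

locale fraction_ring = ring_set R for R :: "'a::field_char_0 set" +
  assumes fraction: "\<exists>d\<in>R. d \<noteq> 0 \<and> d * x \<in> R"
begin

text \<open>The intersection of \<open>R\<close> with the principal fractional ideals generated by
  the elements of \<open>A\<close>. As \<open>x / 0 = 0\<close>, this reading fails for the
  generator 0, which \<open>constructible\<close> therefore excludes.\<close>

definition principal_Inter :: "'a set \<Rightarrow> 'a set" where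
  "principal_Inter A = {x\<in>R. \<forall>a\<in>A. x / a \<in> R}"

definition constructible :: "'a set set" where
  "constructible = {principal_Inter A | A. finite A \<and> 0 \<notin> A}"

lemma constructible_subset: "J \<in> constructible \<Longrightarrow> J \<subseteq> R"
  and constructible_zero: "J \<in> constructible \<Longrightarrow> 0 \<in> J"
  by (auto simp: constructible_def principal_Inter_def zero)

text \<open>The translate of the monoid by \<open>a\<close> is the fractional ideal generated by
  \<open>a\<close> with 0 removed, and a denominator of \<open>x\<close> in \<open>R\<close> writes
  \<open>x\<close> as a left fraction.\<close>

lemma mult_monoid_constructible:
  assumes "J \<in> constructible"
  shows "J - {0} \<in> constructible_ideals mult_group (mult_monoid R)"
proof -
  obtain A where A: "finite A" "0 \<notin> A" "J = principal_Inter A"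
    using assms by (auto simp: constructible_def)
  have constr: "mult_monoid R \<inter> (\<Inter>g\<in>A. g <#\<^bsub>mult_group\<^esub> mult_monoid R)
      \<in> constructible_ideals mult_group (mult_monoid R)"
  proof (rule Inter_cosets_constructible[OF group_mult_group])
    fix x :: 'a assume x: "x \<in> carrier mult_group"
    obtain d where d: "d \<in> R" "d \<noteq> 0" "d * x \<in> R" using fraction by blast
    then have "x = inv\<^bsub>mult_group\<^esub> d \<otimes>\<^bsub>mult_group\<^esub> (d * x)"
      by (simp add: inv_mult_group) (simp add: mult_group_def)
    then show "\<exists>p\<in>mult_monoid R. \<exists>q\<in>mult_monoid R. x = inv\<^bsub>mult_group\<^esub> p \<otimes>\<^bsub>mult_group\<^esub> q"
      using d x by (intro bexI[of _ d] bexI[of _ "d * x"]) (auto simp: mult_monoid_def mult_group_def)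
  qed (use A in \<open>auto simp: mult_group_def mult_monoid_def\<close>)
  have coset: "x \<in> a <#\<^bsub>mult_group\<^esub> mult_monoid R \<longleftrightarrow> x \<noteq> 0 \<and> x / a \<in> R" if aA: "a \<in> A" for a x
  proof
    have a: "a \<noteq> 0" using aA A(2) by blast
    assume "x \<noteq> 0 \<and> x / a \<in> R"
    then have "x = a \<otimes>\<^bsub>mult_group\<^esub> (x / a)" "x / a \<in> mult_monoid R"
      using a by (auto simp: mult_group_def mult_monoid_def)
    then show "x \<in> a <#\<^bsub>mult_group\<^esub> mult_monoid R"
      unfolding l_coset_def by blast
  qed (use aA A(2) in \<open>auto simp: l_coset_def mult_group_def mult_monoid_def\<close>)
  have "mult_monoid R \<inter> (\<Inter>g\<in>A. g <#\<^bsub>mult_group\<^esub> mult_monoid R) = J - {0}"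
    using coset unfolding A(3) by (auto simp: principal_Inter_def mult_monoid_def)
  with constr show ?thesis by simp
qed

text \<open>Translating by \<open>(b, a)\<close> gives the coset of \<open>b\<close> modulo the
  ideal generated by \<open>a\<close>, times that ideal without 0. Intersecting over
  \<open>A\<close> with \<open>b\<close> fixed gives the product; \<open>b\<close> in
  \<open>R\<close> keeps the first factor inside \<open>R\<close>.\<close>

lemma affine_monoid_constructible:
  assumes "J \<in> constructible" and b: "b \<in> R"
  shows "(b +o J) \<times> (J - {0}) \<in> constructible_ideals affine_group (affine_monoid R)"
proof -
  obtain A where A: "finite A" "0 \<notin> A" "J = principal_Inter A"
    using assms by (auto simp: constructible_def)
  have constr: "affine_monoid R \<inter> (\<Inter>g\<in>Pair b ` A. g <#\<^bsub>affine_group\<^esub> affine_monoid R)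
      \<in> constructible_ideals affine_group (affine_monoid R)"
  proof (rule Inter_cosets_constructible[OF group_affine_group])
    fix z :: "'a \<times> 'a" assume z: "z \<in> carrier affine_group"
    obtain y x where zyx: "z = (y, x)" by (cases z)
    obtain d e where d: "d \<in> R" "d \<noteq> 0" "d * x \<in> R" and e: "e \<in> R" "e \<noteq> 0" "e * y \<in> R"
      using fraction by metis
    \<comment> \<open>The product \<open>d * e\<close> is a common denominator of both
      coordinates.\<close>
    define p q where "p = (0::'a, d * e)" and "q = (d * (e * y), e * (d * x))"
    have "p \<in> affine_monoid R" "q \<in> affine_monoid R"
      using d e z by (auto simp: p_def q_def zyx affine_monoid_def mult_monoid_def affine_group_def closed)
    moreover have "z = inv\<^bsub>affine_group\<^esub> p \<otimes>\<^bsub>affine_group\<^esub> q"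
      using d(2) e(2) by (simp add: inv_affine_group p_def) (simp add: affine_group_def q_def zyx)
    ultimately show "\<exists>p\<in>affine_monoid R. \<exists>q\<in>affine_monoid R.
        z = inv\<^bsub>affine_group\<^esub> p \<otimes>\<^bsub>affine_group\<^esub> q"
      by blast
  qed (use A in \<open>auto simp: affine_group_def affine_monoid_def mult_monoid_def\<close>)
  have "(y, x) \<in> (b, a) <#\<^bsub>affine_group\<^esub> affine_monoid R \<longleftrightarrow>
      (y - b) / a \<in> R \<and> x \<noteq> 0 \<and> x / a \<in> R" if aA: "a \<in> A" for a x y
  proof
    have a: "a \<noteq> 0" using aA A(2) by blast
    assume R: "(y - b) / a \<in> R \<and> x \<noteq> 0 \<and> x / a \<in> R"
    have "(y, x) = (b, a) \<otimes>\<^bsub>affine_group\<^esub> ((y - b) / a, x / a)"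
      using a by (simp add: affine_group_def)
    moreover have "((y - b) / a, x / a) \<in> affine_monoid R"
      using a R by (simp add: affine_monoid_def mult_monoid_def)
    ultimately show "(y, x) \<in> (b, a) <#\<^bsub>affine_group\<^esub> affine_monoid R"
      by (auto simp: l_coset_def)
  qed (use aA A(2) in \<open>auto simp: l_coset_def affine_group_def affine_monoid_def mult_monoid_def\<close>)
  moreover have "y - b \<in> R \<longleftrightarrow> y \<in> R" for y
    using diff[OF _ b, of y] add[OF _ b, of "y - b"] by auto
  ultimately have "affine_monoid R \<inter> (\<Inter>g\<in>Pair b ` A. g <#\<^bsub>affine_group\<^esub> affine_monoid R)
      = (b +o J) \<times> (J - {0})"
    unfolding A(3)
    by (auto simp: affine_monoid_def mult_monoid_def principal_Inter_def set_minus_plus[symmetric])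
  with constr show ?thesis by simp
qed

lemma finite_cover_not_independent:
  assumes fin: "finite \<I>" and ne: "\<I> \<noteq> {}" and \<I>: "\<I> \<subseteq> constructible"
    and J: "\<Union>\<I> \<in> constructible" "\<Union>\<I> \<notin> \<I>"
    and index: "\<And>I. I \<in> \<I> \<Longrightarrow> finite ((\<lambda>x. x +o I) ` \<Union>\<I>)"
  shows "\<not> satisfies_independence mult_group (mult_monoid R)"
    and "\<not> satisfies_independence affine_group (affine_monoid R)"
proof -
  let ?J = "\<Union>\<I>"
  \<comment> \<open>Both sets contain 0, so removing it loses no information and strictness
    survives.\<close>
  have eq: "?J = I" if "I \<in> \<I>" "?J - {0} = I - {0}" for I
  proof -
    have "0 \<in> I" "0 \<in> ?J" using constructible_zero[OF J(1)] constructible_zero \<I> that(1) by auto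
    then show ?thesis using that(2) by (metis insert_Diff)
  qed
  define \<M> where "\<M> = (\<lambda>I. I - {0}) ` \<I>"
  have "\<Union>\<M> = ?J - {0}" by (auto simp: \<M>_def)
  moreover have "\<M> \<subseteq> constructible_ideals mult_group (mult_monoid R)"
    using \<I> by (auto simp: \<M>_def mult_monoid_constructible)
  moreover have "?J - {0} \<notin> \<M>"
    using eq J(2) by (auto simp: \<M>_def)
  moreover have "finite \<M>" "\<M> \<noteq> {}" using fin ne by (auto simp: \<M>_def)
  ultimately show "\<not> satisfies_independence mult_group (mult_monoid R)"
    using mult_monoid_constructible[OF J(1)] by (rule not_independentI)
  define \<N> where "\<N> = (\<Union>I\<in>\<I>. (\<lambda>C. C \<times> (I - {0})) ` (\<lambda>b. b +o I) ` ?J)"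
  have self: "b \<in> b +o I" if "I \<in> \<I>" for b I
    using constructible_zero \<I> that by (force simp: elt_set_plus_def)
  have sub: "b + x \<in> ?J" if "b \<in> ?J" "x \<in> ?J" for b x
  proof -
    obtain A where "?J = principal_Inter A" using J(1) by (auto simp: constructible_def)
    then show ?thesis
      using that unfolding principal_Inter_def by (auto simp: add_divide_distrib add)
  qed
  have "\<Union>\<N> = ?J \<times> (?J - {0})"
  proof
    show "\<Union>\<N> \<subseteq> ?J \<times> (?J - {0})"
    proof
      fix z assume "z \<in> \<Union>\<N>"
      then obtain I b where I: "I \<in> \<I>" "b \<in> ?J" "z \<in> (b +o I) \<times> (I - {0})"
        by (auto simp: \<N>_def)
      then obtain y x where "z = (b + y, x)" "y \<in> I" "x \<in> I - {0}"
        by (auto simp: elt_set_plus_def)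
      then show "z \<in> ?J \<times> (?J - {0})" using sub[of b y] I(1,2) by blast
    qed
    show "?J \<times> (?J - {0}) \<subseteq> \<Union>\<N>"
    proof
      fix z assume z: "z \<in> ?J \<times> (?J - {0})"
      then have "snd z \<in> ?J" "snd z \<noteq> 0" by auto
      then obtain I where I: "I \<in> \<I>" "snd z \<in> I - {0}" by blast
      \<comment> \<open>The second coordinate selects the ideal \<open>I\<close>, the first one then
        selects the coset.\<close>
      then have "z \<in> (fst z +o I) \<times> (I - {0})" using self[OF I(1)] by (metis SigmaI prod.collapse)
      moreover have "(fst z +o I) \<times> (I - {0}) \<in> \<N>"
        using z I(1) unfolding \<N>_def by (intro UN_I[OF I(1)] imageI) auto
      ultimately show "z \<in> \<Union>\<N>" by blast
    qed
  qed
  moreover have "\<N> \<subseteq> constructible_ideals affine_group (affine_monoid R)"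
    using \<I> constructible_subset[OF J(1)] by (force simp: \<N>_def intro!: affine_monoid_constructible)
  moreover have "?J \<times> (?J - {0}) \<notin> \<N>"
  proof
    assume "?J \<times> (?J - {0}) \<in> \<N>"
    then obtain I b where I: "I \<in> \<I>" "?J \<times> (?J - {0}) = (b +o I) \<times> (I - {0})"
      by (auto simp: \<N>_def)
    have "?J \<noteq> {}" "b +o I \<noteq> {}" using constructible_zero[OF J(1)] self[OF I(1)] by blast+
    then have "?J - {0} = I - {0}" using I(2) by (auto simp: times_eq_iff)
    then show False using eq[OF I(1)] I(1) J(2) by simp
  qed
  moreover have "finite \<N>" using fin index by (auto simp: \<N>_def)
  moreover have "\<N> \<noteq> {}" using ne constructible_zero[OF J(1)] by (auto simp: \<N>_def)
  moreover have "?J \<times> (?J - {0}) \<in> constructible_ideals affine_group (affine_monoid R)"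
    using affine_monoid_constructible[OF J(1) zero] by simp
  ultimately show "\<not> satisfies_independence affine_group (affine_monoid R)"
    by (rule not_independentI)
qed

end

section \<open>Constructible multiples of the covering\<close>

lemma finite_image_factor:
  assumes "finite (f ` S)" "\<And>x y. x \<in> S \<Longrightarrow> y \<in> S \<Longrightarrow> f x = f y \<Longrightarrow> g x = g y"
  shows "finite (g ` S)"
proof -
  have "g x = g (inv_into S f (f x))" if "x \<in> S" for x
    by (rule assms(2)) (use that in \<open>auto simp: inv_into_into f_inv_into_f\<close>)
  then have "g ` S \<subseteq> (\<lambda>v. g (inv_into S f v)) ` f ` S" by blast
  then show ?thesis using assms(1) finite_subset by blast
qed

text \<open>Each difference gives one inclusion; \<open>T\<close> is only assumed closed under
  addition, so both are required.\<close>

lemma coset_eqI: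
  fixes T :: "'a::ab_group_add set"
  assumes "\<And>s t. s \<in> T \<Longrightarrow> t \<in> T \<Longrightarrow> s + t \<in> T" "x - y \<in> T" "y - x \<in> T"
  shows "x +o T = y +o T"
proof -
  have *: "u +o T \<subseteq> v +o T" if "u - v \<in> T" for u v
  proof
    fix z assume "z \<in> u +o T"
    then obtain t where t: "t \<in> T" "z = u + t" by (auto simp: elt_set_plus_def)
    then have "z = v + ((u - v) + t)" by simp
    then show "z \<in> v +o T" using assms(1)[OF that t(1)] unfolding elt_set_plus_def by blast
  qed
  show ?thesis using *[OF assms(2)] *[OF assms(3)] by blast
qed

section \<open>Fractions, finite index and conductor of the order\<close>

context nonmaximal_order
begin

sublocale fraction_ring R
proof
  fix x :: 'a
  obtain B where "rational_basis B" and R: "R = Zmod.span B"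
    using order_basis[OF number_field order] by blast
  interpret B: rational_basis B by fact
  obtain D :: int where D: "D > 0" "\<And>b. b \<in> B \<Longrightarrow> of_int D * B.coord x b \<in> \<int>"
    using common_denominator[OF B.finite_B] by blast
  \<comment> \<open>Clearing the denominators of the coordinates moves \<open>x\<close> into the
    order.\<close>
  have "of_rat (of_int D) * x \<in> R"
    unfolding R B.in_Zspan_iff B.coord_scale using D(2) by blast
  then show "\<exists>d\<in>R. d \<noteq> 0 \<and> d * x \<in> R"
    using D(1) of_int_in_subring[OF subring] by (intro bexI[of _ "of_int D"]) auto
qed

lemma finite_residues:
  obtains f :: "'a \<Rightarrow> 'a \<Rightarrow> int" where "finite (f ` \<O>\<^sub>K)"
    "\<And>x y. x \<in> \<O>\<^sub>K \<Longrightarrow> y \<in> \<O>\<^sub>K \<Longrightarrow> f x = f y \<Longrightarrow> (x - y) / of_nat m \<in> R"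
proof -
  obtain B where "rational_basis B" and R: "R = Zmod.span B"
    using order_basis[OF number_field order] by blast
  interpret B: rational_basis B by fact
  define c where "c x b = \<lfloor>B.coord (of_nat m * x) b\<rfloor>" for x b
  have c: "B.coord (of_nat m * x) b = of_int (c x b)" if "x \<in> \<O>\<^sub>K" "b \<in> B" for x b
    using m_mult[OF that(1)] that(2) by (auto simp: R B.in_Zspan_iff c_def elim!: Ints_cases)
  \<comment> \<open>For integral \<open>x\<close> the coordinates of \<open>m * x\<close> are
    integers. Agreement modulo the square of \<open>m\<close> puts \<open>m * (x - y)\<close> into
    that square times \<open>R\<close>, so \<open>x - y\<close> lies in \<open>m\<close> times
    \<open>R\<close>. The restriction to \<open>B\<close> leaves finitely many values.\<close>
  define f where "f x = restrict (\<lambda>b. c x b mod int (m * m)) B" for x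
  have "f ` \<O>\<^sub>K \<subseteq> (\<Pi>\<^sub>E b\<in>B. {0..<int (m * m)})"
    using m_pos by (auto simp: f_def)
  moreover have "finite (\<Pi>\<^sub>E b\<in>B. {0..<int (m * m)})"
    by (intro finite_PiE B.finite_B) auto
  ultimately have "finite (f ` \<O>\<^sub>K)" by (rule finite_subset)
  moreover have "(x - y) / of_nat m \<in> R" if xy: "x \<in> \<O>\<^sub>K" "y \<in> \<O>\<^sub>K" "f x = f y" for x y
  proof -
    have "B.coord ((x - y) / of_nat m) b \<in> \<int>" if b: "b \<in> B" for b
    proof -
      have "c x b mod int (m * m) = c y b mod int (m * m)"
        using fun_cong[OF xy(3), of b] b by (simp add: f_def)
      then obtain k where k: "c x b - c y b = int (m * m) * k"
        by (metis mod_eq_dvd_iff dvdE)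
      have "(x - y) / of_nat m = of_rat (1 / of_nat (m * m)) * (of_nat m * x + of_rat (- 1) * (of_nat m * y))"
        using m_pos by (simp add: of_rat_divide of_rat_mult field_simps)
      then have "B.coord ((x - y) / of_nat m) b = 1 / of_nat (m * m) * (of_int (c x b) + (- 1) * of_int (c y b))"
        by (simp only: B.coord_scale B.coord_add c xy b)
      also have "\<dots> = 1 / of_nat (m * m) * of_int (c x b - c y b)" by simp
      also have "\<dots> = of_int k" unfolding k using m_pos by simp
      finally show ?thesis by simp
    qed
    then show ?thesis by (simp add: R B.in_Zspan_iff)
  qed
  ultimately show ?thesis using that by blast
qed

text \<open>Elements with equal residues differ by an element of \<open>m\<close> times
  \<open>R\<close>, hence of \<open>T\<close>, so the residue determines the coset.\<close>

lemma finite_index: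
  assumes "S \<subseteq> \<O>\<^sub>K" "\<And>s t. s \<in> T \<Longrightarrow> t \<in> T \<Longrightarrow> s + t \<in> T"
    "\<And>x. x \<in> R \<Longrightarrow> of_nat m * x \<in> T"
  shows "finite ((\<lambda>x. x +o T) ` S)"
proof -
  obtain f :: "'a \<Rightarrow> 'a \<Rightarrow> int" where f: "finite (f ` \<O>\<^sub>K)"
    "\<And>x y. x \<in> \<O>\<^sub>K \<Longrightarrow> y \<in> \<O>\<^sub>K \<Longrightarrow> f x = f y \<Longrightarrow> (x - y) / of_nat m \<in> R"
    using finite_residues by blast
  have *: "x - y \<in> T" if "x \<in> S" "y \<in> S" "f x = f y" for x y
  proof -
    have "of_nat m * ((x - y) / of_nat m) \<in> T"
      using that assms(1) by (intro assms(3) f(2)) auto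
    then show ?thesis using m_pos by simp
  qed
  show ?thesis
  proof (rule finite_image_factor)
    show "finite (f ` S)" using f(1) assms(1) finite_subset image_mono by metis
  qed (intro coset_eqI assms(2) *; simp)
qed

text \<open>The quotient of \<open>\<O>\<^sub>K\<close> by its multiples of \<open>m\<close> is
  finite, so choosing one element per coset gives a finite \<open>H\<close>, as the definition of
  independence demands a finite union.\<close>

lemma ex_coset_reps:
  obtains H :: "'a set" where "is_nontrivial_coset_reps m H" "finite H"
proof -
  let ?M = "of_nat m *o \<O>\<^sub>K :: 'a set"
  let ?C = "(\<lambda>x. x +o ?M) ` \<O>\<^sub>K"
  have "finite ?C"
    by (rule finite_index)
      (auto simp: elt_set_times_def integral distrib_left[symmetric] intro: OK.add)
  define r where "r = inv_into \<O>\<^sub>K (\<lambda>x. x +o ?M)"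
  have r: "r C \<in> \<O>\<^sub>K" "r C +o ?M = C" if "C \<in> ?C" for C
    using inv_into_into[OF that] f_inv_into_f[OF that] by (simp_all add: r_def)
  have "bij_betw (\<lambda>h. h +o ?M) (r ` (?C - {?M})) (?C - {?M})"
    by (rule bij_betw_byWitness[where f' = r]) (use r in auto)
  then have "is_nontrivial_coset_reps m (r ` (?C - {?M}))"
    unfolding is_nontrivial_coset_reps_def using r(1) by blast
  then show ?thesis using that \<open>finite ?C\<close> by blast
qed

text \<open>An element \<open>x\<close> with \<open>x \<cdot> c \<subseteq> R\<close> for the conductor \<open>c\<close> satisfies \<open>x \<cdot> c \<subseteq> c\<close>, so it is integral
  because \<open>c\<close> is finitely generated.\<close>

lemma integral_iff_conductor_generators:
  obtains F where "finite F" "F \<subseteq> conductor R"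
    "\<And>x. x \<in> \<O>\<^sub>K \<longleftrightarrow> (\<forall>f\<in>F. x * f \<in> R)"
proof -
  obtain B where "rational_basis B" and R: "R = Zmod.span B"
    using order_basis[OF number_field order] by blast
  interpret B: rational_basis B by fact
  obtain res :: "'a \<Rightarrow> 'a \<Rightarrow> int" where res: "finite (res ` \<O>\<^sub>K)"
    "\<And>x y. x \<in> \<O>\<^sub>K \<Longrightarrow> y \<in> \<O>\<^sub>K \<Longrightarrow> res x = res y \<Longrightarrow> (x - y) / of_nat m \<in> R"
    using finite_residues by blast
  have cR: "conductor R \<subseteq> R"
    using OK.one by (force simp: mem_conductor_iff)
  then have cOK: "conductor R \<subseteq> \<O>\<^sub>K" using integral by blast
  have m_c: "of_nat m * x \<in> conductor R" if "x \<in> \<O>\<^sub>K" for x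
    using m_mult OK.mult[OF that] by (simp add: mem_conductor_iff mult.assoc)
  \<comment> \<open>The multiples of \<open>B\<close> generate \<open>m\<close> times
    \<open>R\<close>, and one representative is added for each residue met by the conductor. The
    element \<open>m\<close> itself supplies a nonzero generator for the determinant trick.\<close>
  define F where
    "F = insert (of_nat m) ((\<lambda>b. of_nat m * b) ` B \<union> inv_into (conductor R) res ` res ` conductor R)"
  have "finite (res ` conductor R)"
    using res(1) cOK by (meson finite_subset image_mono)
  then have finF: "finite F" using B.finite_B by (simp add: F_def)
  have "B \<subseteq> \<O>\<^sub>K" using Zmod.span_superset[of B] R integral by blast
  then have Fc: "F \<subseteq> conductor R"
    using m_c[OF OK.one] m_c by (auto simp: F_def inv_into_into)
  have c_span: "conductor R \<subseteq> Zmod.span F"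
  proof
    fix y assume y: "y \<in> conductor R"
    define z where "z = inv_into (conductor R) res (res y)"
    have z: "z \<in> conductor R" "res z = res y"
      using y by (auto simp: z_def inv_into_into f_inv_into_f)
    have zF: "z \<in> F" using y by (simp add: F_def z_def)
    have "(y - z) / of_nat m \<in> Zmod.span B"
      using res(2)[of y z] y z cOK R by auto
    moreover have "B \<subseteq> {r. of_nat m * r \<in> Zmod.span F}"
      by (auto simp: F_def intro: Zmod.span_base)
    moreover have "Zmod.subspace {r. of_nat m * r \<in> Zmod.span F}"
    proof (rule Zmod.subspaceI)
      fix k r assume "r \<in> {r. of_nat m * r \<in> Zmod.span F}"
      then show "int_scale k r \<in> {r. of_nat m * r \<in> Zmod.span F}"
        using Zmod.span_scale[of "of_nat m * r" F k] by (simp add: int_scale_def mult.left_commute)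
    qed (auto simp: distrib_left Zmod.span_zero Zmod.span_add)
    ultimately have "of_nat m * ((y - z) / of_nat m) \<in> Zmod.span F"
      using Zmod.span_minimal by blast
    then have "y - z \<in> Zmod.span F" using m_pos by simp
    then show "y \<in> Zmod.span F"
      using Zmod.span_add[OF _ Zmod.span_base[OF zF]] by fastforce
  qed
  have "x \<in> \<O>\<^sub>K" if x: "\<forall>f\<in>F. x * f \<in> R" for x
  proof -
    have "Zmod.subspace {y. x * y \<in> R}"
    proof (rule Zmod.subspaceI)
      fix k y assume "y \<in> {y. x * y \<in> R}"
      then show "int_scale k y \<in> {y. x * y \<in> R}"
        using mult[OF of_int_in_subring[OF subring, of k], of "x * y"]
        by (simp add: int_scale_def mult.left_commute)
    qed (auto simp: distrib_left closed)
    then have xc: "x * y \<in> R" if "y \<in> conductor R" for y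
      using Zmod.span_minimal[of F "{y. x * y \<in> R}"] x c_span that by blast
    \<comment> \<open>The conductor is an ideal of \<open>\<O>\<^sub>K\<close>, so \<open>f\<close>
      may be replaced by any of its integral multiples.\<close>
    have "x * f \<in> conductor R" if "f \<in> F" for f
      using that Fc xc by (auto simp: mem_conductor_iff mult.assoc OK.mult)
    then show ?thesis
      using algebraic_int_if_stabilizes[OF finF, of "of_nat m" x] c_span m_pos
      by (auto simp: ring_of_integers_def F_def)
  qed
  moreover have "x * f \<in> R" if "x \<in> \<O>\<^sub>K" "f \<in> F" for x f
  proof -
    have "f \<in> conductor R" using that(2) Fc by blast
    then show ?thesis using that(1) unfolding mem_conductor_iff by (metis mult.commute)
  qed
  ultimately show ?thesis using that[OF finF Fc] by blast
qed

text \<open>Integrality of \<open>x / m\<close> is tested on conductor generators \<open>f\<close>: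
  it says that \<open>x\<close> lies in every fractional ideal generated by \<open>m / f\<close>.
  Zero generators impose no condition and are dropped. The factor \<open>m\<close> moves everything
  inside \<open>R\<close>.\<close>

lemma constructible_multiples:
  shows "of_nat m *o \<O>\<^sub>K \<in> constructible"
    and "h \<in> \<O>\<^sub>K \<Longrightarrow> h \<noteq> 0 \<Longrightarrow> of_nat m *o covering_ideal R h \<in> constructible"
proof -
  obtain F where F: "finite F" "\<And>x. x \<in> \<O>\<^sub>K \<longleftrightarrow> (\<forall>f\<in>F. x * f \<in> R)"
    using integral_iff_conductor_generators by metis
  define A where "A = (\<lambda>f. of_nat m / f) ` (F - {0})"
  have A: "finite A" "0 \<notin> A" using F(1) m_pos by (auto simp: A_def)
  have in_R: "x \<in> R" if "x / of_nat m \<in> \<O>\<^sub>K" for x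
    using m_mult[OF that] m_pos by simp
  have mem: "x / of_nat m \<in> \<O>\<^sub>K \<longleftrightarrow> (\<forall>a\<in>A. x / a \<in> R)" for x
    using zero by (auto simp: F(2) A_def)
  have "of_nat m *o \<O>\<^sub>K = principal_Inter A"
    using m_pos mem in_R by (auto simp: mem_scale_iff principal_Inter_def)
  then show "of_nat m *o \<O>\<^sub>K \<in> constructible"
    using A by (auto simp: constructible_def)
  assume h: "h \<in> \<O>\<^sub>K" "h \<noteq> 0"
  \<comment> \<open>The condition that cuts \<open>covering_ideal R h\<close> out of
    \<open>\<O>\<^sub>K\<close>, rescaled by \<open>m\<close>, is divisibility by this single extra
    generator.\<close>
  define a where "a = (if cofactor h \<in> conductor R then of_nat m * of_nat m else of_nat m) / cofactor h"
  have a: "a \<noteq> 0" using m_pos cofactor_nonzero[OF h] by (simp add: a_def)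
  have "x / of_nat m \<in> covering_ideal R h \<longleftrightarrow> x / of_nat m \<in> \<O>\<^sub>K \<and> x / a \<in> R" for x
    by (simp add: mem_covering_ideal_iff[OF h] a_def mult.commute)
  then have "of_nat m *o covering_ideal R h = principal_Inter (insert a A)"
    using m_pos mem in_R by (auto simp: mem_scale_iff principal_Inter_def)
  then show "of_nat m *o covering_ideal R h \<in> constructible"
    using A a by (auto simp: constructible_def)
qed

section \<open>Failure of independence for the order\<close>

lemma not_independent:
  shows "\<not> satisfies_independence mult_group (mult_monoid R)"
    and "\<not> satisfies_independence affine_group (affine_monoid R)"
proof -
  obtain H :: "'a set" where H: "is_nontrivial_coset_reps m H" "finite H"
    using ex_coset_reps by blast
  note reps = coset_reps[OF H(1)]
  have m0: "of_nat m \<noteq> (0 :: 'a)" using m_pos by simp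
  define \<I> where "\<I> = (\<lambda>h. of_nat m *o covering_ideal R h) ` H"
  have fin: "finite \<I>" and ne: "\<I> \<noteq> {}" using H(2) reps(3) by (auto simp: \<I>_def)
  have sub: "\<I> \<subseteq> constructible"
    using constructible_multiples(2) reps(1,2) by (auto simp: \<I>_def)
  have Union: "\<Union>\<I> = of_nat m *o \<O>\<^sub>K"
  proof (rule Set.set_eqI)
    fix x :: 'a
    have "x / of_nat m \<in> \<O>\<^sub>K \<longleftrightarrow> (\<exists>h\<in>H. x / of_nat m \<in> covering_ideal R h)"
      by (subst covering[OF H(1)]) simp
    then show "x \<in> \<Union>\<I> \<longleftrightarrow> x \<in> of_nat m *o \<O>\<^sub>K"
      by (simp add: \<I>_def mem_scale_iff[OF m0])
  qed
  have J: "\<Union>\<I> \<in> constructible" by (simp add: Union constructible_multiples(1))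
  have neq: "of_nat m *o \<O>\<^sub>K \<noteq> of_nat m *o covering_ideal R h" if "h \<in> H" for h
  proof -
    obtain x where "x \<in> \<O>\<^sub>K" "x \<notin> covering_ideal R h"
      using covering_ideal_proper reps(1,2) \<open>h \<in> H\<close> by blast
    then have "of_nat m * x \<in> of_nat m *o \<O>\<^sub>K" "of_nat m * x \<notin> of_nat m *o covering_ideal R h"
      using m0 by (auto simp: mem_scale_iff[OF m0])
    then show ?thesis by metis
  qed
  have not_mem: "\<Union>\<I> \<notin> \<I>"
  proof
    assume "\<Union>\<I> \<in> \<I>"
    then show False unfolding Union unfolding \<I>_def by (rule imageE) (use neq in metis)
  qed
  have index: "finite ((\<lambda>x. x +o I) ` \<Union>\<I>)" if I: "I \<in> \<I>" for I
  proof -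
    obtain h where h: "h \<in> H" "I = of_nat m *o covering_ideal R h"
      using I unfolding \<I>_def by (rule imageE)
    have hO: "h \<in> \<O>\<^sub>K" "h \<noteq> 0" using h(1) reps(1,2) by auto
    have "finite ((\<lambda>z. z +o covering_ideal R h) ` \<O>\<^sub>K)"
      by (rule finite_index)
        (simp_all add: covering_ideal_add[OF hO] multiple_in_covering_ideal[OF hO] integral)
    then have "finite ((\<lambda>C. of_nat m *o C) ` (\<lambda>z. z +o covering_ideal R h) ` \<O>\<^sub>K)"
      by (rule finite_imageI)
    \<comment> \<open>Multiplication by \<open>m\<close> carries the cosets of
      \<open>covering_ideal R h\<close> in \<open>\<O>\<^sub>K\<close> to the cosets of
      \<open>I\<close> in the union, so finiteness of the index transfers.\<close>
    also have "(\<lambda>C. of_nat m *o C) ` (\<lambda>z. z +o covering_ideal R h) ` \<O>\<^sub>K = (\<lambda>x. x +o I) ` \<Union>\<I>"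
    proof -
      have "of_nat m *o \<O>\<^sub>K = (*) (of_nat m) ` (\<O>\<^sub>K :: 'a set)"
        by (auto simp: elt_set_times_def)
      then show ?thesis by (simp add: Union h(2) image_image set_times_plus_distrib)
    qed
    finally show ?thesis .
  qed
  show "\<not> satisfies_independence mult_group (mult_monoid R)"
    and "\<not> satisfies_independence affine_group (affine_monoid R)"
    using finite_cover_not_independent[OF fin ne sub J not_mem index] by blast+
qed

end

theorem proposition9p4:
  fixes R :: "'a::field_char_0 set"
  assumes "is_number_field TYPE('a)"
    and "is_nonmaximal_order R"
  shows "(\<forall>H. is_nontrivial_coset_reps (least_mult R) H \<longrightarrow>
            (\<forall>h\<in>H. cofactor h \<in> \<O>\<^sub>K \<and>
               is_fractional_ideal R (covering_ideal R h) \<and>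
               h +o (of_nat (least_mult R) *o \<O>\<^sub>K) \<subseteq> covering_ideal R h \<and>
               covering_ideal R h \<subset> \<O>\<^sub>K) \<and>
            \<O>\<^sub>K = (\<Union>h\<in>H. covering_ideal R h)) \<and>
         \<not> satisfies_independence mult_group (mult_monoid R) \<and>
         \<not> satisfies_independence affine_group (affine_monoid R)"
proof -
  have "is_subring R"
    using assms(2) unfolding is_nonmaximal_order_def is_order_def by simp
  then interpret nonmaximal_order R
    using assms by unfold_locales
  show ?thesis
    unfolding m_def[symmetric]
  proof (intro conjI allI impI ballI not_independent)
    fix H :: "'a set" assume H: "is_nontrivial_coset_reps m H"
    note reps = coset_reps(1,2)[OF H]
    show "\<O>\<^sub>K = (\<Union>h\<in>H. covering_ideal R h)" by (rule covering[OF H])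
    fix h assume h: "h \<in> H"
    note hO = reps[OF h]
    show "cofactor h \<in> \<O>\<^sub>K" by (rule cofactor_integral[OF hO])
    show "is_fractional_ideal R (covering_ideal R h)" by (rule covering_ideal_fractional[OF hO])
    show "h +o (of_nat m *o \<O>\<^sub>K) \<subseteq> covering_ideal R h"
      by (rule coset_subset_covering_ideal[OF hO])
    show "covering_ideal R h \<subset> \<O>\<^sub>K" by (rule covering_ideal_proper[OF hO])
  qed
qed

end
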